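(* Let $q\in[0,1)$ be a constant and, for each $N\in\mathbb N$, let $\mathcal A=\mathcal A_N$ be an arbitrary nonempty $k$-uniform family of subsets of $[N]$ (every member has exactly $k=k_N\ge1$ elements), and let $p=p_N\in(0,1)$. Let $\psi_q=(\psi_q)_N$ be the $q$-modified fractional expectation threshold of $\mathcal A$ and $\mathrm{MinMax}(\mathcal A,p)$ the minimax rate of the planted subset model. Then, as $N\to\infty$: (a) If $\lim_N p/\psi_q=+\infty$, then $\liminf_N\mathrm{MinMax}(\mathcal A,p)\ge 1-q$. (b) If $\lim_N p/\psi_q=0$, then $\limsup_N\mathrm{MinMax}(\mathcal A,p)\le 1-q$.
   Context: Planted subset model: let $\mathcal X=[N]$ and $\mathcal A=\{A_1,\dots,A_m\}$ a family of $k$-element subsets of $\mathcal X$. For a prior (probability distribution) $\pi$ on $\mathcal A$, draw $A\sim\pi$ and an independent random subset $X_p\subseteq\mathcal X$ containing each element independently with probability $p$, and observe $Y=A\cup X_p$. Set $$\mathrm{MMSE}_N(p,\pi)=\frac1k\min_{\hat A}\mathbb E\|\mathbf 1_A-\hat A(Y)\|_2^2=\frac1k\,\mathbb E\|\mathbf 1_A-\mathbb E[\mathbf 1_A\mid Y]\|_2^2,$$ the minimum being over all (randomized) estimators $\hat A:2^{\mathcal X}\to\mathbb R^N$, and $$\mathrm{MinMax}(\mathcal A,p)=\max_\pi\mathrm{MMSE}_N(p,\pi),$$ the maximum being over all priors $\pi$ on $\mathcal A$. For $q\in[0,1)$, $$\psi_q=(\psi_q)_N=\min_{S\subseteq\mathcal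 X,\ |S|\le qk}\ \max_{w\in W_S}\ \mathcal E_w^{-1}(1/2),$$ where, given $S\subseteq\mathcal X$, $\mathcal E_w(x)=\sum_{T\subseteq\mathcal X}w(T)x^{|T\setminus S|}$ and $W_S$ is the set of all functions $w:2^{\mathcal X}\to[0,1]$ such that: (1) $w(T)=0$ unless $|T|\ge qk$ and $S\subseteq T$; (2) for every $A_i\in\mathcal A$ with $S\subseteq A_i$, $\sum_{T\subseteq A_i}w(T)\ge1$. Here $\mathcal E_w^{-1}(1/2)$ is understood as $\sup\{x\ge0:\mathcal E_w(x)\le1/2\}$ (equal to $+\infty$ if $\mathcal E_w\le 1/2$ on all of $[0,\infty)$, and to $0$ if the set is empty). *)

theory Defs
  imports "HOL-Probability.Probability"
begin

text \<open>
  The ground set \<open>[N]\<close> is \<open>{1..N}\<close>. All quantities below take values in \<^typ>\<open>ennreal\<close>,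
  a complete lattice, so that every infimum and supremum is well defined (and \<open>Sup {} = 0\<close>).
\<close>

definition random_subset :: "nat \<Rightarrow> real \<Rightarrow> nat set pmf" where
  "random_subset N p =
     map_pmf (\<lambda>b. {i \<in> {1..N}. b i}) (Pi_pmf {1..N} False (\<lambda>_. bernoulli_pmf p))"

text \<open>
  A randomized estimator with values in \<open>\<real>\<^sup>N\<close> maps each observation \<open>Y \<subseteq> [N]\<close> to the
  probability distribution of its output; deterministic estimators are the point masses.
\<close>

definition estimators :: "nat \<Rightarrow> (nat set \<Rightarrow> (nat \<Rightarrow> real) measure) set" where
  "estimators N = (Pow {1..N} \<rightarrow> space (prob_algebra (Pi\<^sub>M {1..N} (\<lambda>_. borel))))"

definition mean_square_error ::
    "nat \<Rightarrow> real \<Rightarrow> nat set pmf \<Rightarrow> (nat set \<Rightarrow> (nat \<Rightarrow> real) measure) \<Rightarrow> ennreal" where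
  "mean_square_error N p \<pi> K =
     (\<integral>\<^sup>+ (A, X). (\<integral>\<^sup>+ z. ennreal (\<Sum>i\<in>{1..N}. (indicator A i - z i)\<^sup>2) \<partial>K (A \<union> X))
        \<partial>measure_pmf (pair_pmf \<pi> (random_subset N p)))"

definition MMSE :: "nat \<Rightarrow> nat \<Rightarrow> real \<Rightarrow> nat set pmf \<Rightarrow> ennreal" where
  "MMSE N k p \<pi> = (INF K\<in>estimators N. mean_square_error N p \<pi> K) / of_nat k"

definition MinMax :: "nat \<Rightarrow> nat \<Rightarrow> nat set set \<Rightarrow> real \<Rightarrow> ennreal" where
  "MinMax N k \<A> p = (SUP \<pi>\<in>{\<pi>. set_pmf \<pi> \<subseteq> \<A>}. MMSE N k p \<pi>)"

definition weight_poly :: "nat \<Rightarrow> nat set \<Rightarrow> (nat set \<Rightarrow> real) \<Rightarrow> real \<Rightarrow> real" where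
  "weight_poly N S w x = (\<Sum>T\<in>Pow {1..N}. w T * x ^ card (T - S))"

text \<open>Only the values of \<open>w\<close> on subsets of \<open>[N]\<close> are constrained, and only they are ever used.\<close>

definition weights ::
    "nat \<Rightarrow> nat \<Rightarrow> nat set set \<Rightarrow> real \<Rightarrow> nat set \<Rightarrow> (nat set \<Rightarrow> real) set" where
  "weights N k \<A> q S =
     {w \<in> Pow {1..N} \<rightarrow> {0..1}.
        (\<forall>T\<in>Pow {1..N}. \<not> (real (card T) \<ge> q * real k \<and> S \<subseteq> T) \<longrightarrow> w T = 0) \<and>
        (\<forall>A\<in>\<A>. S \<subseteq> A \<longrightarrow> (\<Sum>T\<in>Pow A. w T) \<ge> 1)}"

text \<open>
  \<open>\<E>\<^sub>w\<^sup>-\<^sup>1(1/2)\<close>: as a supremum in \<^typ>\<open>ennreal\<close> it is \<open>\<infinity>\<close> if \<open>\<E>\<^sub>w \<le> 1/2\<close> throughout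
  \<open>[0, \<infinity>)\<close>, and \<open>0\<close> if the set is empty.
\<close>

definition half_point :: "nat \<Rightarrow> nat set \<Rightarrow> (nat set \<Rightarrow> real) \<Rightarrow> ennreal" where
  "half_point N S w = (SUP x\<in>{x. 0 \<le> x \<and> weight_poly N S w x \<le> 1/2}. ennreal x)"

definition psi :: "nat \<Rightarrow> nat \<Rightarrow> nat set set \<Rightarrow> real \<Rightarrow> ennreal" where
  "psi N k \<A> q =
     (INF S\<in>{S. S \<subseteq> {1..N} \<and> real (card S) \<le> q * real k}.
        SUP w\<in>weights N k \<A> q S. half_point N S w)"

end

theory Submission
  imports Defs
begin

text \<open>
  The posterior mean is optimal, so the MMSE under a prior is \<open>1 - \<bbbE> \<bar>A \<inter> A'\<bar> / k\<close>, where \<open>A'\<close>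
  is an independent sample from the posterior.

  If \<open>p \<lless> \<psi>\<close>, each small \<open>S\<close> carries a cover \<open>w\<^sub>S\<close> with \<open>\<E>(L p) \<le> 1/2\<close> and \<open>L\<close> large. A
  member \<open>A' \<subseteq> A \<union> X\<close> with \<open>A \<inter> A' = S\<close> small forces \<open>T - S \<subseteq> X\<close> for a set of \<open>T\<close>'s of
  \<open>w\<^sub>S\<close>-weight at least 1; by a union bound over the at most \<open>2\<^sup>k\<close> sets \<open>S \<subseteq> A\<close> this has small
  probability, so posterior samples overlap \<open>A\<close> in almost \<open>q k\<close> elements whatever the prior.

  If \<open>p \<ggreater> \<psi>\<close>, linear programming duality at a minimising \<open>S\<close> yields a prior on the members
  containing \<open>S\<close> with \<open>\<pi>(A \<supseteq> T) \<le> 2 (p/L)\<close> to the power \<open>\<bar>T - S\<bar>\<close> for \<open>\<bar>T\<bar> \<ge> q k\<close>, and a truncated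
  second moment computation bounds the overlap by \<open>(q + o(1)) k\<close>.
\<close>

section \<open>Matrix games\<close>

text \<open>In the product topology on functions from an arbitrary type, the conditions cut a closed
  set out of a power of the unit interval, which is compact by Tychonoff. Pinning the coordinates
  off \<open>I\<close> to 0 keeps all points inside this cube.\<close>

lemma compact_simplex:
  fixes I :: "'a set"
  assumes "finite I"
  shows "compact {u :: 'a \<Rightarrow> real. (\<forall>i. 0 \<le> u i) \<and> (\<forall>i. i \<notin> I \<longrightarrow> u i = 0) \<and> sum u I = 1}"
    (is "compact ?D")
proof -
  have cube: "compact (PiE UNIV (\<lambda>_::'a. {0..1::real}))"
    using compactin_PiE[of "\<lambda>_. euclidean" "UNIV :: 'a set" "\<lambda>_. {0..1::real}"]
    by (simp add: euclidean_product_topology)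
  have "closed ((\<Inter>i. {u. 0 \<le> u i}) \<inter> (\<Inter>i\<in>-I. {u. u i = 0}) \<inter> {u :: 'a \<Rightarrow> real. sum u I = 1})"
    by (intro closed_Int closed_INT ballI closed_Collect_le closed_Collect_eq continuous_intros
        continuous_on_product_coordinates)
  also have "(\<Inter>i. {u. 0 \<le> u i}) \<inter> (\<Inter>i\<in>-I. {u. u i = 0}) \<inter> {u :: 'a \<Rightarrow> real. sum u I = 1} = ?D"
    by auto
  finally have "closed ?D" .
  moreover have "?D \<subseteq> PiE UNIV (\<lambda>_::'a. {0..1::real})"
  proof
    fix u assume u: "u \<in> ?D"
    have "u i \<le> 1" for i
    proof (cases "i \<in> I")
      case True
      then have "u i \<le> sum u I" using assms u by (intro member_le_sum) auto
      then show ?thesis using u by simp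
    qed (use u in auto)
    then show "u \<in> PiE UNIV (\<lambda>_::'a. {0..1::real})" using u by auto
  qed
  ultimately show ?thesis
    using compact_Int_closed[OF cube, of ?D] by (simp add: Int_absorb1)
qed

text \<open>For small \<open>t\<close> the linear term dominates, so a negative slope would make the
  quadratic negative. This is the first-order condition at a minimiser over a convex set.\<close>

lemma slope_nonneg_if_quadratic_nonneg:
  fixes b c :: real
  assumes "\<And>t. 0 < t \<Longrightarrow> t \<le> 1 \<Longrightarrow> 0 \<le> t * b + t\<^sup>2 * c" and "0 \<le> c"
  shows "0 \<le> b"
proof (rule ccontr)
  assume "\<not> 0 \<le> b"
  then have b: "b < 0" by simp
  \<comment> \<open>Small enough that the quadratic term uses up at most half of the slope:
    \<open>t * c \<le> - b / 2\<close> leaves \<open>b + t * c \<le> b / 2 < 0\<close>.\<close>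
  define t where "t = - b / (2 * c - b)"
  have t: "0 < t" "t \<le> 1" using b \<open>0 \<le> c\<close> by (auto simp: t_def field_simps)
  have "0 \<le> t * (b + t * c)" using assms(1)[OF t] by (simp add: power2_eq_square algebra_simps)
  then have "0 \<le> b + t * c" using t by (simp add: zero_le_mult_iff)
  moreover have "t * c \<le> - b / 2"
  proof -
    have "- b * c * 2 \<le> - b * (2 * c - b)" using b by (simp add: algebra_simps)
    then show ?thesis using b \<open>0 \<le> c\<close> by (simp add: t_def field_simps)
  qed
  ultimately show False using b by simp
qed

text \<open>
  The weights \<open>y\<close> are the excesses over \<open>v\<close> at a minimiser of the sum of squared excesses:
  optimality in the direction of each vertex of the simplex is the second alternative.
\<close>

lemma matrix_game_alternative:
  fixes M :: "'a \<Rightarrow> 'b \<Rightarrow> real" and v :: real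
  assumes I: "finite I" "I \<noteq> {}" and J: "finite J"
  obtains (row) u where "\<And>i. 0 \<le> u i" "\<And>i. i \<notin> I \<Longrightarrow> u i = 0" "sum u I = 1"
      "\<And>j. j \<in> J \<Longrightarrow> (\<Sum>i\<in>I. u i * M i j) \<le> v"
    | (col) y where "\<And>j. 0 \<le> y j" "\<And>i. i \<in> I \<Longrightarrow> v * sum y J < (\<Sum>j\<in>J. y j * M i j)"
proof -
  define D where "D = {u :: 'a \<Rightarrow> real. (\<forall>i. 0 \<le> u i) \<and> (\<forall>i. i \<notin> I \<longrightarrow> u i = 0) \<and> sum u I = 1}"
  define G where "G u j = (\<Sum>i\<in>I. u i * M i j)" for u :: "'a \<Rightarrow> real" and j
  define F where "F u = (\<Sum>j\<in>J. (max 0 (G u j - v))\<^sup>2)" for u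
  define vertex where "vertex a = (\<lambda>i. if i = a then 1 else 0 :: real)" for a :: 'a
  have vertex: "vertex a \<in> D" if "a \<in> I" for a
    using that I by (auto simp: D_def vertex_def)
  have G_vertex: "G (vertex a) j = M a j" if "a \<in> I" for a j
    using that I by (simp add: G_def vertex_def if_distrib[of "\<lambda>x. x * _"] cong: if_cong)
  have "continuous_on D F"
    unfolding F_def G_def
    by (intro continuous_intros continuous_on_subset[OF continuous_on_product_coordinates]) auto
  moreover have "compact D" unfolding D_def by (rule compact_simplex[OF I(1)])
  moreover have "D \<noteq> {}" using vertex I(2) by auto
  ultimately obtain u where u: "u \<in> D" and min: "\<And>u'. u' \<in> D \<Longrightarrow> F u \<le> F u'"
    using continuous_attains_inf[of D F] by auto
  define y where "y j = max 0 (G u j - v)" for j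
  have opt: "0 \<le> (\<Sum>j\<in>J. y j * (M a j - G u j))" if a: "a \<in> I" for a
  proof -
    define d where "d j = M a j - G u j" for j
    have "0 \<le> t * (2 * (\<Sum>j\<in>J. y j * d j)) + t\<^sup>2 * (\<Sum>j\<in>J. (d j)\<^sup>2)" if t: "0 < t" "t \<le> 1" for t
    proof -
      \<comment> \<open>Moving from the minimiser towards the vertex \<open>a\<close> stays in the
        simplex and changes each \<open>G\<close> linearly in \<open>t\<close>.\<close>
      define u' where "u' i = (1 - t) * u i + t * vertex a i" for i
      have G_u': "G u' j = G u j + t * d j" for j
      proof -
        have "G u' j = (1 - t) * G u j + t * G (vertex a) j"
          unfolding G_def u'_def by (simp add: sum_distrib_left sum.distrib sum_subtractf algebra_simps)
        then show ?thesis using G_vertex[OF a] by (simp add: d_def algebra_simps)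
      qed
      have "u' \<in> D" using u vertex[OF a] t
        by (auto simp: D_def u'_def sum.distrib simp flip: sum_distrib_left)
      then have "F u \<le> F u'" by (rule min)
      also have "\<dots> \<le> (\<Sum>j\<in>J. (y j)\<^sup>2 + 2 * t * (y j * d j) + t\<^sup>2 * (d j)\<^sup>2)"
        unfolding F_def
      proof (rule sum_mono)
        fix j
        \<comment> \<open>Since \<open>y j\<close> dominates \<open>G u j - v\<close>, a nonnegative
          new excess is at most \<open>y j + t * d j\<close>; a negative one contributes 0. The
          positive part is thus replaced by a polynomial in \<open>t\<close>.\<close>
        have "(max 0 (G u' j - v))\<^sup>2 \<le> (y j + t * d j)\<^sup>2"
          unfolding G_u' y_def by (cases "0 \<le> G u j + t * d j - v") (auto intro!: power_mono)
        then show "(max 0 (G u' j - v))\<^sup>2 \<le> (y j)\<^sup>2 + 2 * t * (y j * d j) + t\<^sup>2 * (d j)\<^sup>2"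
          by (simp add: power2_eq_square algebra_simps)
      qed
      also have "\<dots> = F u + (t * (2 * (\<Sum>j\<in>J. y j * d j)) + t\<^sup>2 * (\<Sum>j\<in>J. (d j)\<^sup>2))"
        by (simp add: F_def y_def sum.distrib sum_distrib_left algebra_simps)
      finally show ?thesis by simp
    qed
    then have "0 \<le> 2 * (\<Sum>j\<in>J. y j * d j)"
      by (rule slope_nonneg_if_quadratic_nonneg) (auto intro: sum_nonneg)
    then show ?thesis by (simp add: d_def)
  qed
  show thesis
  proof (cases "\<forall>j\<in>J. G u j \<le> v")
    case True
    then show thesis using u by (intro row[of u]) (auto simp: D_def G_def)
  next
    case False
    then obtain j0 where j0: "j0 \<in> J" "v < G u j0" by auto
    show thesis
    proof (rule col[of y])
      fix a assume a: "a \<in> I"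
      \<comment> \<open>Each difference \<open>y j * G u j - v * y j\<close> equals
        \<open>(y j)\<^sup>2\<close>, which is positive at \<open>j0\<close>.\<close>
      have "v * sum y J < (\<Sum>j\<in>J. y j * G u j)"
        unfolding sum_distrib_left
      proof (rule sum_strict_mono_ex1[OF J])
        show "\<forall>j\<in>J. v * y j \<le> y j * G u j"
          by (auto simp: y_def max_def mult.commute intro!: mult_right_mono)
        show "\<exists>j\<in>J. v * y j < y j * G u j"
          using j0 by (intro bexI[of _ j0]) (auto simp: y_def mult.commute intro!: mult_strict_right_mono)
      qed
      also have "\<dots> \<le> (\<Sum>j\<in>J. y j * M a j)"
        using opt[OF a] by (simp add: algebra_simps sum_subtractf)
      finally show "v * sum y J < (\<Sum>j\<in>J. y j * M a j)" .
    qed (auto simp: y_def)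
  qed
qed

section \<open>The minimum mean square error\<close>

declare One_nat_def [simp del]

section \<open>Laws of the random subset and of the observation\<close>

definition observation_pmf :: "nat \<Rightarrow> real \<Rightarrow> nat set \<Rightarrow> nat set pmf" where
  "observation_pmf N p A = map_pmf (\<lambda>X. A \<union> X) (random_subset N p)"

text \<open>Independence of the coordinates. A set \<open>B i\<close> of Booleans can force a point
  in, force it out or leave it free, so one product formula serves superset events and exact
  observations alike.\<close>

lemma prob_random_subset_box:
  "measure_pmf.prob (random_subset N p) {X. \<forall>i\<in>{1..N}. (i \<in> X) \<in> B i} =
     (\<Prod>i\<in>{1..N}. measure_pmf.prob (bernoulli_pmf p) (B i))"
proof -
  have "measure_pmf.prob (random_subset N p) {X. \<forall>i\<in>{1..N}. (i \<in> X) \<in> B i} =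
      measure_pmf.prob (Pi_pmf {1..N} False (\<lambda>_. bernoulli_pmf p)) (Pi {1..N} B)"
    unfolding random_subset_def measure_map_pmf by (rule arg_cong[where f = "measure _"]) auto
  then show ?thesis by (simp add: measure_Pi_pmf_Pi)
qed

lemma set_random_subset: "set_pmf (random_subset N p) \<subseteq> Pow {1..N}"
  by (auto simp: random_subset_def)

lemma prod_power_card:
  fixes x :: "'a :: comm_monoid_mult"
  assumes "finite I"
  shows "(\<Prod>i\<in>I. if i \<in> T then x else 1) = x ^ card (I \<inter> T)"
  using assms by (simp add: prod.If_cases)

lemma prob_random_subset_superset:
  assumes "T \<subseteq> {1..N}" "0 \<le> p" "p \<le> 1"
  shows "measure_pmf.prob (random_subset N p) {X. T \<subseteq> X} = p ^ card T"
proof -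
  have eq: "{X. T \<subseteq> X} = {X. \<forall>i\<in>{1..N}. (i \<in> X) \<in> (if i \<in> T then {True} else UNIV)}"
    using assms(1) by (auto split: if_splits)
  then have "measure_pmf.prob (random_subset N p) {X. T \<subseteq> X} =
      (\<Prod>i\<in>{1..N}. if i \<in> T then p else 1)"
    unfolding eq prob_random_subset_box using assms
    by (intro prod.cong) (auto simp: measure_pmf_single)
  then show ?thesis using assms(1) by (simp add: prod_power_card Int_absorb1)
qed

lemma pmf_observation:
  assumes "A \<subseteq> {1..N}" "0 \<le> p" "p \<le> 1"
  shows "pmf (observation_pmf N p A) Y =
    (if A \<subseteq> Y \<and> Y \<subseteq> {1..N} then p ^ card (Y - A) * (1 - p) ^ card ({1..N} - Y) else 0)"
proof (cases "A \<subseteq> Y \<and> Y \<subseteq> {1..N}")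
  case False
  have "Y \<notin> set_pmf (observation_pmf N p A)"
    using False assms(1) set_random_subset[of N p] by (auto simp: observation_pmf_def)
  then show ?thesis using False by (auto simp: set_pmf_iff)
next
  case True
  \<comment> \<open>Points of \<open>A\<close> lie in the observation anyway, so their membership in
    \<open>X\<close> is free; elsewhere \<open>X\<close> must agree with \<open>Y\<close>.\<close>
  define B where "B i = (if i \<in> A then UNIV else {i \<in> Y})" for i
  have "pmf (observation_pmf N p A) Y = measure_pmf.prob (random_subset N p) {X. A \<union> X = Y}"
    by (simp add: observation_pmf_def pmf_map vimage_def)
  also have "\<dots> = measure_pmf.prob (random_subset N p) {X. \<forall>i\<in>{1..N}. (i \<in> X) \<in> B i}"
  proof (rule measure_pmf.finite_measure_eq_AE)
    show "AE X in measure_pmf (random_subset N p).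
        X \<in> {X. A \<union> X = Y} \<longleftrightarrow> X \<in> {X. \<forall>i\<in>{1..N}. (i \<in> X) \<in> B i}"
    proof (rule AE_pmfI)
      fix X assume "X \<in> set_pmf (random_subset N p)"
      then have "X \<subseteq> {1..N}" using set_random_subset by blast
      then show "X \<in> {X. A \<union> X = Y} \<longleftrightarrow> X \<in> {X. \<forall>i\<in>{1..N}. (i \<in> X) \<in> B i}"
        using True unfolding B_def by (auto split: if_splits)
    qed
  qed auto
  also have "\<dots> = (\<Prod>i\<in>{1..N}. measure_pmf.prob (bernoulli_pmf p) (B i))"
    by (rule prob_random_subset_box)
  also have "\<dots> = (\<Prod>i\<in>{1..N}. (if i \<in> Y - A then p else 1) * (if i \<in> -Y then 1 - p else 1))"
    using True assms by (intro prod.cong) (auto simp: B_def measure_pmf_single)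
  also have "\<dots> = p ^ card ({1..N} \<inter> (Y - A)) * (1 - p) ^ card ({1..N} \<inter> - Y)"
    by (simp only: prod.distrib prod_power_card finite_atLeastAtMost)
  also have "{1..N} \<inter> (Y - A) = Y - A" using True by auto
  also have "{1..N} \<inter> - Y = {1..N} - Y" by auto
  finally show ?thesis using True by simp
qed

lemma sum_pmf_observation:
  assumes "A \<subseteq> {1..N}"
  shows "(\<Sum>Y\<in>Pow {1..N}. pmf (observation_pmf N p A) Y) = 1"
  using assms set_random_subset[of N p] by (intro sum_pmf_eq_1) (auto simp: observation_pmf_def)

text \<open>Bias-variance decomposition with unnormalised weights, meant for \<open>joint\<close> at
  a fixed observation. The first identity shows that the mean minimises the weighted squared error,
  the second evaluates the minimum.\<close>

lemma weighted_variance_decomposition: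
  fixes a x :: "'a \<Rightarrow> real"
  assumes "finite F" "\<And>A. A \<in> F \<Longrightarrow> 0 \<le> a A"
  defines "m \<equiv> (\<Sum>A\<in>F. a A * x A) / sum a F"
  shows "(\<Sum>A\<in>F. a A * (x A - z)\<^sup>2) = (\<Sum>A\<in>F. a A * (x A - m)\<^sup>2) + sum a F * (m - z)\<^sup>2"
    and "(\<Sum>A\<in>F. a A * (x A - m)\<^sup>2) = (\<Sum>A\<in>F. a A * (x A)\<^sup>2) - (\<Sum>A\<in>F. a A * x A)\<^sup>2 / sum a F"
proof -
  have ax: "(\<Sum>A\<in>F. a A * x A) = m * sum a F"
  proof (cases "sum a F = 0")
    \<comment> \<open>With zero total mass every weight vanishes, so the value of \<open>m\<close>
      produced by division by zero is harmless.\<close>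
    case True
    then have "a A = 0" if "A \<in> F" for A using that assms sum_nonneg_eq_0_iff[of F a] by auto
    then show ?thesis by simp
  qed (simp add: m_def)
  have expand: "(\<Sum>A\<in>F. a A * (x A - z)\<^sup>2) =
      (\<Sum>A\<in>F. a A * (x A)\<^sup>2) - 2 * z * (\<Sum>A\<in>F. a A * x A) + z\<^sup>2 * sum a F" for z
    by (simp add: power2_diff sum_distrib_left sum_distrib_right sum_subtractf sum.distrib algebra_simps)
  show "(\<Sum>A\<in>F. a A * (x A - z)\<^sup>2) = (\<Sum>A\<in>F. a A * (x A - m)\<^sup>2) + sum a F * (m - z)\<^sup>2"
    unfolding expand ax by (simp add: power2_eq_square algebra_simps)
  have "(\<Sum>A\<in>F. a A * x A)\<^sup>2 / sum a F = m\<^sup>2 * sum a F"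
    unfolding ax by (simp add: power2_eq_square)
  then show "(\<Sum>A\<in>F. a A * (x A - m)\<^sup>2) =
      (\<Sum>A\<in>F. a A * (x A)\<^sup>2) - (\<Sum>A\<in>F. a A * x A)\<^sup>2 / sum a F"
    unfolding expand ax by (simp add: power2_eq_square algebra_simps)
qed

lemma weight_poly_mono:
  assumes "w \<in> weights N k \<A> q S" "0 \<le> x" "x \<le> y"
  shows "weight_poly N S w x \<le> weight_poly N S w y"
  using assms unfolding weight_poly_def weights_def
  by (intro sum_mono mult_left_mono power_mono) (auto simp: Pi_iff)

locale planted_family =
  fixes N k :: nat and \<F> :: "nat set set" and p :: real
  assumes k: "1 \<le> k" and p: "0 < p" "p < 1"
    and family: "\<And>A. A \<in> \<F> \<Longrightarrow> A \<subseteq> {1..N}" "\<And>A. A \<in> \<F> \<Longrightarrow> card A = k"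
begin

section \<open>Posterior, overlap and mean square error for a fixed prior\<close>

abbreviation "obs \<equiv> observation_pmf N p"

text \<open>Unnormalised posterior: where its sum over \<open>\<F>\<close> is positive, dividing by
  that sum gives the conditional law of the planted set given \<open>Y\<close>.\<close>

definition joint :: "nat set pmf \<Rightarrow> nat set \<Rightarrow> nat set \<Rightarrow> real" where
  "joint \<pi> Y A = pmf \<pi> A * pmf (obs A) Y"

definition posterior_mean :: "nat set pmf \<Rightarrow> nat set \<Rightarrow> nat \<Rightarrow> real" where
  "posterior_mean \<pi> Y i = (\<Sum>A\<in>\<F>. joint \<pi> Y A * indicator A i) / sum (joint \<pi> Y) \<F>"

text \<open>The expected overlap of the planted set with an independent sample from the posterior.\<close>

definition overlap :: "nat set pmf \<Rightarrow> real" where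
  "overlap \<pi> = (\<Sum>Y\<in>Pow {1..N}. \<Sum>A\<in>\<F>. \<Sum>A'\<in>\<F>.
     joint \<pi> Y A * joint \<pi> Y A' / sum (joint \<pi> Y) \<F> * card (A \<inter> A'))"

lemma finite_family [simp]: "finite \<F>"
  using family(1) by (intro finite_subset[of \<F> "Pow {1..N}"]) auto

lemma joint_nonneg [simp]: "0 \<le> joint \<pi> Y A"
  by (simp add: joint_def)

lemma overlap_nonneg: "0 \<le> overlap \<pi>"
  by (auto simp: overlap_def intro!: sum_nonneg mult_nonneg_nonneg divide_nonneg_nonneg)

lemma sum_joint:
  assumes "set_pmf \<pi> \<subseteq> \<F>"
  shows "(\<Sum>Y\<in>Pow {1..N}. \<Sum>A\<in>\<F>. joint \<pi> Y A) = 1"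
proof -
  have "(\<Sum>Y\<in>Pow {1..N}. \<Sum>A\<in>\<F>. joint \<pi> Y A) =
      (\<Sum>A\<in>\<F>. pmf \<pi> A * (\<Sum>Y\<in>Pow {1..N}. pmf (obs A) Y))"
    unfolding joint_def sum_distrib_left by (rule sum.swap)
  also have "\<dots> = 1" using assms by (simp add: sum_pmf_observation family(1) sum_pmf_eq_1)
  finally show ?thesis .
qed

lemma sum_indicator_Int:
  assumes "A \<in> \<F>"
  shows "(\<Sum>i\<in>{1..N}. indicator A i * indicator A' i) = real (card (A \<inter> A'))"
proof -
  have "(\<Sum>i\<in>{1..N}. indicator A i * indicator A' i :: real) = (\<Sum>i\<in>{1..N}. indicator (A \<inter> A') i)"
    by (simp add: indicator_inter_arith)
  also have "\<dots> = real (card ({1..N} \<inter> (A \<inter> A')))" by (auto simp: indicator_def sum.If_cases intro!: arg_cong[where f = card])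
  also have "{1..N} \<inter> (A \<inter> A') = A \<inter> A'" using family(1)[OF assms] by auto
  finally show ?thesis .
qed

text \<open>Apply the variance identity in each coordinate. The squared indicators add up to
  \<open>card A = k\<close>, and the square of the mean expands over pairs whose coordinate products
  add up to \<open>card (A \<inter> A')\<close>.\<close>

lemma sum_posterior_variance:
  assumes "set_pmf \<pi> \<subseteq> \<F>"
  shows "(\<Sum>Y\<in>Pow {1..N}. \<Sum>A\<in>\<F>. joint \<pi> Y A * (\<Sum>i\<in>{1..N}. (indicator A i - posterior_mean \<pi> Y i)\<^sup>2))
    = real k - overlap \<pi>"
proof -
  have "(\<Sum>A\<in>\<F>. joint \<pi> Y A * (\<Sum>i\<in>{1..N}. (indicator A i - posterior_mean \<pi> Y i)\<^sup>2)) =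
      real k * sum (joint \<pi> Y) \<F> - (\<Sum>A\<in>\<F>. \<Sum>A'\<in>\<F>.
     joint \<pi> Y A * joint \<pi> Y A' / sum (joint \<pi> Y) \<F> * card (A \<inter> A'))" for Y
  proof -
    have "(\<Sum>A\<in>\<F>. joint \<pi> Y A * (\<Sum>i\<in>{1..N}. (indicator A i - posterior_mean \<pi> Y i)\<^sup>2)) =
        (\<Sum>i\<in>{1..N}. \<Sum>A\<in>\<F>. joint \<pi> Y A * (indicator A i - posterior_mean \<pi> Y i)\<^sup>2)"
      unfolding sum_distrib_left by (rule sum.swap)
    also have "\<dots> = (\<Sum>i\<in>{1..N}. (\<Sum>A\<in>\<F>. joint \<pi> Y A * indicator A i) -
        (\<Sum>A\<in>\<F>. joint \<pi> Y A * indicator A i)\<^sup>2 / sum (joint \<pi> Y) \<F>)"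
      unfolding posterior_mean_def
      by (subst weighted_variance_decomposition(2)) (simp_all add: power2_eq_square flip: indicator_inter_arith)
    also have "\<dots> = (\<Sum>A\<in>\<F>. joint \<pi> Y A * (\<Sum>i\<in>{1..N}. indicator A i * indicator A i)) -
        (\<Sum>A\<in>\<F>. \<Sum>A'\<in>\<F>. joint \<pi> Y A * joint \<pi> Y A' / sum (joint \<pi> Y) \<F> *
          (\<Sum>i\<in>{1..N}. indicator A i * indicator A' i))"
    proof -
      have "(\<Sum>i\<in>{1..N}. (\<Sum>A\<in>\<F>. joint \<pi> Y A * indicator A i)\<^sup>2 / sum (joint \<pi> Y) \<F>) =
        (\<Sum>i\<in>{1..N}. \<Sum>A\<in>\<F>. \<Sum>A'\<in>\<F>. joint \<pi> Y A * joint \<pi> Y A' / sum (joint \<pi> Y) \<F> *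
          (indicator A i * indicator A' i))"
        unfolding power2_eq_square sum_product sum_divide_distrib by (intro sum.cong refl) simp
      also have "\<dots> = (\<Sum>A\<in>\<F>. \<Sum>A'\<in>\<F>. joint \<pi> Y A * joint \<pi> Y A' / sum (joint \<pi> Y) \<F> *
          (\<Sum>i\<in>{1..N}. indicator A i * indicator A' i))"
        unfolding sum_distrib_left
        by (subst sum.swap, intro sum.cong refl, rule sum.swap)
      moreover have "(\<Sum>i\<in>{1..N}. \<Sum>A\<in>\<F>. joint \<pi> Y A * indicator A i) =
          (\<Sum>A\<in>\<F>. joint \<pi> Y A * (\<Sum>i\<in>{1..N}. indicator A i * indicator A i))"
        unfolding sum_distrib_left by (subst sum.swap) (simp flip: indicator_inter_arith)
      ultimately show ?thesis by (simp add: sum_subtractf)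
    qed
    also have "\<dots> = real k * sum (joint \<pi> Y) \<F> - (\<Sum>A\<in>\<F>. \<Sum>A'\<in>\<F>.
     joint \<pi> Y A * joint \<pi> Y A' / sum (joint \<pi> Y) \<F> * card (A \<inter> A'))"
    proof -
      have "(\<Sum>A\<in>\<F>. joint \<pi> Y A * (\<Sum>i\<in>{1..N}. indicator A i * indicator A i)) =
          real k * sum (joint \<pi> Y) \<F>"
        unfolding sum_distrib_left[of "real k"]
        by (intro sum.cong refl) (simp only: sum_indicator_Int Int_absorb family(2) mult.commute)
      then show ?thesis by (simp only: sum_indicator_Int cong: sum.cong)
    qed
    finally show ?thesis .
  qed
  then show ?thesis
    using sum_joint[OF assms] by (simp add: overlap_def sum_subtractf flip: sum_distrib_left)
qed

text \<open>An estimator sees only \<open>Y\<close>, so grouping by observation allows a separate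
  optimisation for each \<open>Y\<close>.\<close>

lemma mean_square_error_eq:
  assumes "set_pmf \<pi> \<subseteq> \<F>"
  shows "mean_square_error N p \<pi> K = (\<Sum>Y\<in>Pow {1..N}. \<Sum>A\<in>\<F>. ennreal (joint \<pi> Y A) *
     (\<integral>\<^sup>+ z. ennreal (\<Sum>i\<in>{1..N}. (indicator A i - z i)\<^sup>2) \<partial>K Y))"
proof -
  define h where "h A Y = (\<integral>\<^sup>+ z. ennreal (\<Sum>i\<in>{1..N}. (indicator A i - z i)\<^sup>2) \<partial>K Y)" for A Y
  have inner: "(\<integral>\<^sup>+ X. h A (A \<union> X) \<partial>measure_pmf (random_subset N p)) =
      (\<Sum>Y\<in>Pow {1..N}. h A Y * ennreal (pmf (obs A) Y))" if "A \<in> \<F>" for A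
  proof -
    have supp: "set_pmf (obs A) \<subseteq> Pow {1..N}"
      using family(1)[OF that] set_random_subset[of N p] by (auto simp: observation_pmf_def)
    have "(\<integral>\<^sup>+ X. h A (A \<union> X) \<partial>measure_pmf (random_subset N p)) = (\<integral>\<^sup>+ Y. h A Y \<partial>measure_pmf (obs A))"
      by (simp add: observation_pmf_def)
    also have "\<dots> = (\<Sum>Y\<in>set_pmf (obs A). h A Y * ennreal (pmf (obs A) Y))"
      using finite_subset[OF supp] by (intro nn_integral_measure_pmf_finite) auto
    also have "\<dots> = (\<Sum>Y\<in>Pow {1..N}. h A Y * ennreal (pmf (obs A) Y))"
      using supp by (intro sum.mono_neutral_left) (auto simp: set_pmf_iff)
    finally show ?thesis .
  qed
  have "mean_square_error N p \<pi> K =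
      (\<integral>\<^sup>+ A. \<integral>\<^sup>+ X. h A (A \<union> X) \<partial>measure_pmf (random_subset N p) \<partial>measure_pmf \<pi>)"
    by (simp add: mean_square_error_def nn_integral_pair_pmf' h_def)
  also have "\<dots> = (\<Sum>A\<in>set_pmf \<pi>. (\<integral>\<^sup>+ X. h A (A \<union> X) \<partial>measure_pmf (random_subset N p)) * ennreal (pmf \<pi> A))"
    using finite_subset[OF assms] by (intro nn_integral_measure_pmf_finite) auto
  also have "\<dots> = (\<Sum>A\<in>\<F>. (\<integral>\<^sup>+ X. h A (A \<union> X) \<partial>measure_pmf (random_subset N p)) * ennreal (pmf \<pi> A))"
    using assms by (intro sum.mono_neutral_left) (auto simp: set_pmf_iff)
  also have "\<dots> = (\<Sum>A\<in>\<F>. \<Sum>Y\<in>Pow {1..N}. ennreal (joint \<pi> Y A) * h A Y)"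
    by (intro sum.cong refl)
      (simp add: inner joint_def ennreal_mult sum_distrib_left sum_distrib_right mult_ac)
  also have "\<dots> = (\<Sum>Y\<in>Pow {1..N}. \<Sum>A\<in>\<F>. ennreal (joint \<pi> Y A) * h A Y)"
    by (rule sum.swap)
  finally show ?thesis unfolding h_def .
qed

text \<open>For each \<open>Y\<close> the posterior mean is at least as good as any output
  \<open>z\<close>, and averaging over a random \<open>z\<close> preserves this. The point mass at
  the posterior mean attains the bound.\<close>

lemma MMSE_eq:
  assumes "set_pmf \<pi> \<subseteq> \<F>"
  shows "MMSE N k p \<pi> = ennreal (1 - overlap \<pi> / k)"
proof -
  define M where "M = (\<Pi>\<^sub>M i\<in>{1..N}. (borel :: real measure))"
  define sq where "sq A z = (\<Sum>i\<in>{1..N}. (indicator A i - z i)\<^sup>2 :: real)" for A and z :: "nat \<Rightarrow> real"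
  \<comment> \<open>Restricting to \<open>{1..N}\<close> makes the vector a point of the product
    space, as \<open>estimators\<close> requires.\<close>
  define m where "m Y = (\<lambda>i\<in>{1..N}. posterior_mean \<pi> Y i)" for Y
  have sq_m: "sq A (m Y) = (\<Sum>i\<in>{1..N}. (indicator A i - posterior_mean \<pi> Y i)\<^sup>2)" for A Y
    by (simp add: sq_def m_def)
  have sq_nonneg [simp]: "0 \<le> sq A z" for A z by (auto simp: sq_def intro!: sum_nonneg)
  have meas [measurable]: "(\<lambda>z. sq A z) \<in> borel_measurable M" for A
    unfolding sq_def M_def by measurable
  have total: "(\<Sum>Y\<in>Pow {1..N}. \<Sum>A\<in>\<F>. ennreal (joint \<pi> Y A) * ennreal (sq A (m Y))) =
      ennreal (real k - overlap \<pi>)"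
    unfolding sum_posterior_variance[OF assms, symmetric] sq_m[symmetric]
    by (simp add: ennreal_mult[symmetric] sum_ennreal sum_nonneg)
  have lower: "ennreal (real k - overlap \<pi>) \<le> mean_square_error N p \<pi> K"
    if K: "K \<in> estimators N" for K
    unfolding total[symmetric] mean_square_error_eq[OF assms] sq_def[symmetric]
  proof (rule sum_mono)
    fix Y assume Y: "Y \<in> Pow {1..N}"
    have KY: "sets (K Y) = sets M" "prob_space (K Y)"
      using K Y by (auto simp: estimators_def space_prob_algebra M_def)
    interpret prob_space "K Y" by (rule KY(2))
    have [measurable]: "(\<lambda>z. sq A z) \<in> borel_measurable (K Y)" for A
      using meas[of A] by (simp cong: measurable_cong_sets add: KY(1))
    have "(\<Sum>A\<in>\<F>. ennreal (joint \<pi> Y A) * ennreal (sq A (m Y))) =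
        ennreal (\<Sum>A\<in>\<F>. joint \<pi> Y A * sq A (m Y))"
      by (simp add: ennreal_mult[symmetric] sum_ennreal)
    also have "\<dots> = (\<integral>\<^sup>+ z. ennreal (\<Sum>A\<in>\<F>. joint \<pi> Y A * sq A (m Y)) \<partial>K Y)"
      by (simp add: emeasure_space_1)
    also have "\<dots> \<le> (\<integral>\<^sup>+ z. (\<Sum>A\<in>\<F>. ennreal (joint \<pi> Y A) * ennreal (sq A z)) \<partial>K Y)"
    proof (rule nn_integral_mono)
      fix z
      have swap: "(\<Sum>A\<in>\<F>. joint \<pi> Y A * sq A z) =
          (\<Sum>i\<in>{1..N}. \<Sum>A\<in>\<F>. joint \<pi> Y A * (indicator A i - z i)\<^sup>2)" for z
        unfolding sq_def sum_distrib_left by (rule sum.swap)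
      have "(\<Sum>A\<in>\<F>. joint \<pi> Y A * (indicator A i - m Y i)\<^sup>2) \<le>
          (\<Sum>A\<in>\<F>. joint \<pi> Y A * (indicator A i - z i)\<^sup>2)" if "i \<in> {1..N}" for i
        using that weighted_variance_decomposition(1)[of \<F> "joint \<pi> Y" "\<lambda>A. indicator A i" "z i"]
        by (simp add: m_def posterior_mean_def sum_nonneg)
      then have "(\<Sum>A\<in>\<F>. joint \<pi> Y A * sq A (m Y)) \<le> (\<Sum>A\<in>\<F>. joint \<pi> Y A * sq A z)"
        unfolding swap by (rule sum_mono)
      then show "ennreal (\<Sum>A\<in>\<F>. joint \<pi> Y A * sq A (m Y)) \<le>
          (\<Sum>A\<in>\<F>. ennreal (joint \<pi> Y A) * ennreal (sq A z))"
        by (simp add: ennreal_mult[symmetric] sum_ennreal ennreal_leI)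
    qed
    also have "\<dots> = (\<Sum>A\<in>\<F>. ennreal (joint \<pi> Y A) * (\<integral>\<^sup>+ z. ennreal (sq A z) \<partial>K Y))"
      by (subst nn_integral_sum) (auto intro!: sum.cong nn_integral_cmult)
    finally show "(\<Sum>A\<in>\<F>. ennreal (joint \<pi> Y A) * ennreal (sq A (m Y))) \<le>
        (\<Sum>A\<in>\<F>. ennreal (joint \<pi> Y A) * (\<integral>\<^sup>+ z. ennreal (sq A z) \<partial>K Y))" .
  qed
  have m_space: "m Y \<in> space M" for Y by (simp add: m_def M_def space_PiM)
  have "(\<lambda>Y. return M (m Y)) \<in> estimators N"
    using m_space by (auto simp: estimators_def space_prob_algebra M_def intro!: prob_space_return)
  moreover have "mean_square_error N p \<pi> (\<lambda>Y. return M (m Y)) = ennreal (real k - overlap \<pi>)"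
    unfolding total[symmetric] mean_square_error_eq[OF assms] sq_def[symmetric]
    by (intro sum.cong refl) (simp add: nn_integral_return m_space)
  ultimately have "(INF K\<in>estimators N. mean_square_error N p \<pi> K) = ennreal (real k - overlap \<pi>)"
    using lower by (intro antisym INF_greatest) (auto intro: INF_lower2)
  then have "MMSE N k p \<pi> = ennreal (real k - overlap \<pi>) / ennreal (real k)"
    by (simp add: MMSE_def ennreal_of_nat_eq_real_of_nat)
  also have "\<dots> = ennreal (1 - overlap \<pi> / k)"
  proof -
    have "0 \<le> real k - overlap \<pi>"
      unfolding sum_posterior_variance[OF assms, symmetric]
      by (intro sum_nonneg mult_nonneg_nonneg) auto
    then show ?thesis using k by (simp add: divide_ennreal diff_divide_distrib)
  qed
  finally show ?thesis .
qed

section \<open>Overlap below the threshold\<close>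

lemma joint_nonzero_imp_subset:
  assumes "A \<in> \<F>" "joint \<pi> Y A \<noteq> 0"
  shows "A \<subseteq> Y"
  using assms p by (auto simp: joint_def pmf_observation family(1) split: if_splits)

text \<open>Union bound over \<open>S = A \<inter> A'\<close> and over the sets \<open>T\<close>
  weighted by \<open>w S\<close>. The slack \<open>d\<close> forces
  \<open>card (T - S) \<ge> d * k\<close>, so evaluating at \<open>p\<close> instead of
  \<open>L * p\<close> gains a factor of at most \<open>\<theta> / 2 ^ k\<close>, which pays for the
  at most \<open>2 ^ k\<close> choices of \<open>S\<close>.\<close>

lemma prob_small_overlap_le:
  fixes q d L \<theta> :: real
  assumes A: "A \<in> \<F>" and L: "1 \<le> L" and d: "0 \<le> d"
    and decay: "\<And>n. d * k \<le> real n \<Longrightarrow> 2 ^ k * (1 / L) ^ n \<le> \<theta>"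
    and w: "\<And>S. S \<subseteq> {1..N} \<Longrightarrow> card S \<le> q * k \<Longrightarrow>
      w S \<in> weights N k \<F> q S \<and> weight_poly N S (w S) (L * p) \<le> 1 / 2"
  shows "measure_pmf.prob (random_subset N p)
    {X. \<exists>A'\<in>\<F>. A' \<subseteq> A \<union> X \<and> card (A \<inter> A') < (q - d) * k} \<le> \<theta>"
    (is "measure_pmf.prob ?R ?bad \<le> \<theta>")
proof -
  define \<S> where "\<S> = {S. S \<subseteq> A \<and> card S < (q - d) * k}"
  define f where "f X = (\<Sum>S\<in>\<S>. \<Sum>T\<in>Pow {1..N}. w S T * indicator {X. T - S \<subseteq> X} X)" for X
  have A_sub: "A \<subseteq> {1..N}" using family(1)[OF A] .
  then have fin_A: "finite A" by (rule finite_subset) simp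
  have fin_\<S>: "finite \<S>" using fin_A by (auto simp: \<S>_def)
  have \<S>: "S \<subseteq> {1..N}" "card S \<le> q * k" if "S \<in> \<S>" for S
  proof -
    show "S \<subseteq> {1..N}" using that A_sub by (auto simp: \<S>_def)
    have "0 \<le> d * k" using d by simp
    then show "card S \<le> q * k" using that by (auto simp: \<S>_def algebra_simps)
  qed
  have w_nonneg: "0 \<le> w S T" if "S \<in> \<S>" "T \<in> Pow {1..N}" for S T
    using w[OF \<S>[OF that(1)]] that(2) by (auto simp: weights_def Pi_iff)
  have fin_R: "finite (set_pmf ?R)"
    using set_random_subset by (rule finite_subset) simp
  have cover: "indicator ?bad X \<le> f X" for X
  proof (cases "X \<in> ?bad")
    case True
    then obtain A' where A': "A' \<in> \<F>" "A' \<subseteq> A \<union> X" and small: "card (A \<inter> A') < (q - d) * k"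
      by auto
    define S where "S = A \<inter> A'"
    have S: "S \<in> \<S>" using small by (auto simp: S_def \<S>_def)
    have "1 \<le> (\<Sum>T\<in>Pow A'. w S T)"
      using w[OF \<S>[OF S]] A'(1) by (auto simp: weights_def S_def)
    \<comment> \<open>For \<open>T \<subseteq> A'\<close> the points of \<open>T - S\<close> lie in
      \<open>A'\<close> but not in \<open>A\<close>, hence in \<open>X\<close>, so every indicator
      is 1.\<close>
    also have "\<dots> = (\<Sum>T\<in>Pow A'. w S T * indicator {X. T - S \<subseteq> X} X)"
      using A'(2) by (intro sum.cong refl) (auto simp: S_def indicator_def)
    also have "\<dots> \<le> (\<Sum>T\<in>Pow {1..N}. w S T * indicator {X. T - S \<subseteq> X} X)"
      using family(1)[OF A'(1)] by (intro sum_mono2) (auto intro!: mult_nonneg_nonneg w_nonneg[OF S])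
    also have "\<dots> \<le> f X"
      unfolding f_def by (rule member_le_sum[OF S]) (auto intro!: sum_nonneg mult_nonneg_nonneg w_nonneg fin_\<S>)
    finally show ?thesis using True by simp
  next
    case False
    then show ?thesis
      by (auto simp: f_def intro!: sum_nonneg mult_nonneg_nonneg w_nonneg)
  qed
  have "measure_pmf.prob ?R ?bad = measure_pmf.expectation ?R (indicator ?bad)" by simp
  also have "\<dots> \<le> measure_pmf.expectation ?R f"
    using cover fin_R by (intro integral_mono integrable_measure_pmf_finite) auto
  also have "\<dots> = (\<Sum>S\<in>\<S>. \<Sum>T\<in>Pow {1..N}. w S T * measure_pmf.prob ?R {X. T - S \<subseteq> X})"
    unfolding f_def using integrable_measure_pmf_finite[OF fin_R]
    by (subst Bochner_Integration.integral_sum, blast, intro sum.cong refl,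
        subst Bochner_Integration.integral_sum, blast, intro sum.cong refl) simp
  also have "\<dots> = (\<Sum>S\<in>\<S>. \<Sum>T\<in>Pow {1..N}. w S T * p ^ card (T - S))"
    using p by (intro sum.cong refl) (subst prob_random_subset_superset, auto)
  also have "\<dots> \<le> (\<Sum>S\<in>\<S>. \<theta> / 2 ^ k)"
  proof (rule sum_mono)
    fix S assume S: "S \<in> \<S>"
    have wS: "w S \<in> weights N k \<F> q S" "weight_poly N S (w S) (L * p) \<le> 1 / 2"
      using w[OF \<S>[OF S]] by auto
    have fin_S: "finite S" using \<S>(1)[OF S] by (rule finite_subset) simp
    \<comment> \<open>Taking \<open>n\<close> to be the ceiling of \<open>d * k\<close> in
      \<open>decay\<close> shows that \<theta> is nonnegative.\<close>
    have "0 \<le> 2 ^ k * (1 / L) ^ nat \<lceil>d * k\<rceil>" using L by simp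
    also have "\<dots> \<le> \<theta>" by (rule decay) linarith
    finally have \<theta>: "0 \<le> \<theta>" .
    have "(\<Sum>T\<in>Pow {1..N}. w S T * p ^ card (T - S)) \<le>
        (\<Sum>T\<in>Pow {1..N}. (\<theta> / 2 ^ k) * (w S T * (L * p) ^ card (T - S)))"
    proof (rule sum_mono)
      fix T assume T: "T \<in> Pow {1..N}"
      show "w S T * p ^ card (T - S) \<le> (\<theta> / 2 ^ k) * (w S T * (L * p) ^ card (T - S))"
      proof (cases "w S T = 0")
        case False
        then have "q * k \<le> card T" "S \<subseteq> T" using wS(1) T by (auto simp: weights_def)
        then have "real (card T) = card S + real (card (T - S))"
          using fin_S T by (auto simp: card_Diff_subset of_nat_diff card_mono finite_subset)
        moreover have "card S < q * k - d * k" using S by (auto simp: \<S>_def algebra_simps)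
        ultimately have "d * k \<le> card (T - S)" using \<open>q * k \<le> card T\<close> by linarith
        then have "(1 / L) ^ card (T - S) \<le> \<theta> / 2 ^ k" using decay by (simp add: field_simps)
        then have "(w S T * (L * p) ^ card (T - S)) * (1 / L) ^ card (T - S) \<le>
            (w S T * (L * p) ^ card (T - S)) * (\<theta> / 2 ^ k)"
          using w_nonneg[OF S T] L p by (intro mult_left_mono) auto
        moreover have "(L * p) ^ card (T - S) * (1 / L) ^ card (T - S) = p ^ card (T - S)"
          using L by (simp flip: power_mult_distrib)
        ultimately show ?thesis by (simp add: mult_ac)
      qed simp
    qed
    also have "\<dots> = (\<theta> / 2 ^ k) * weight_poly N S (w S) (L * p)"
      by (simp add: weight_poly_def sum_distrib_left)
    also have "\<dots> \<le> (\<theta> / 2 ^ k) * 1" using wS(2) \<theta> by (intro mult_left_mono) auto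
    finally show "(\<Sum>T\<in>Pow {1..N}. w S T * p ^ card (T - S)) \<le> \<theta> / 2 ^ k" by simp
  qed
  also have "\<dots> = card \<S> * (\<theta> / 2 ^ k)" by simp
  also have "\<dots> \<le> 2 ^ k * (\<theta> / 2 ^ k)"
  proof (rule mult_right_mono)
    have "card \<S> \<le> card (Pow A)" using fin_A by (intro card_mono) (auto simp: \<S>_def)
    then show "real (card \<S>) \<le> 2 ^ k"
      using fin_A family(2)[OF A] by (simp add: card_Pow flip: of_nat_le_iff)
    have "0 \<le> 2 ^ k * (1 / L) ^ nat \<lceil>d * k\<rceil>" using L by simp
    also have "\<dots> \<le> \<theta>" by (rule decay) linarith
    finally show "0 \<le> \<theta> / 2 ^ k" by simp
  qed
  finally show ?thesis by simp
qed

text \<open>Every \<open>A'\<close> of positive posterior mass lies inside \<open>Y\<close>. On a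
  good observation all of them meet \<open>A\<close> in at least \<open>r\<close> points; bad
  observations contribute at least 0.\<close>

lemma overlap_ge:
  fixes r \<theta> :: real
  assumes \<pi>: "set_pmf \<pi> \<subseteq> \<F>" and r: "0 \<le> r"
    and \<theta>: "\<And>A. A \<in> \<F> \<Longrightarrow> measure_pmf.prob (random_subset N p)
      {X. \<exists>A'\<in>\<F>. A' \<subseteq> A \<union> X \<and> card (A \<inter> A') < r} \<le> \<theta>"
  shows "r * (1 - \<theta>) \<le> overlap \<pi>"
proof -
  define good where "good A Y \<longleftrightarrow> (\<forall>A'\<in>\<F>. A' \<subseteq> Y \<longrightarrow> r \<le> card (A \<inter> A'))" for A Y
  have prob_good: "1 - \<theta> \<le> (\<Sum>Y\<in>Pow {1..N}. pmf (obs A) Y * of_bool (good A Y))" if A: "A \<in> \<F>" for A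
  proof -
    have "(\<Sum>Y\<in>Pow {1..N}. pmf (obs A) Y * of_bool (\<not> good A Y)) =
        (\<Sum>Y\<in>{Y \<in> Pow {1..N}. \<not> good A Y}. pmf (obs A) Y)"
      by (rule sum.mono_neutral_cong_right) auto
    also have "\<dots> = measure_pmf.prob (obs A) {Y \<in> Pow {1..N}. \<not> good A Y}"
      by (simp add: measure_measure_pmf_finite)
    also have "\<dots> \<le> measure_pmf.prob (obs A) {Y. \<not> good A Y}"
      by (rule measure_pmf.finite_measure_mono) auto
    also have "\<dots> = measure_pmf.prob (random_subset N p) {X. \<exists>A'\<in>\<F>. A' \<subseteq> A \<union> X \<and> card (A \<inter> A') < r}"
      by (simp add: observation_pmf_def good_def vimage_def not_le Bex_def)
    also have "\<dots> \<le> \<theta>" by (rule \<theta>[OF A])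
    finally have "(\<Sum>Y\<in>Pow {1..N}. pmf (obs A) Y * of_bool (\<not> good A Y)) \<le> \<theta>" .
    moreover have "(\<Sum>Y\<in>Pow {1..N}. pmf (obs A) Y * of_bool (good A Y)) +
        (\<Sum>Y\<in>Pow {1..N}. pmf (obs A) Y * of_bool (\<not> good A Y)) = (\<Sum>Y\<in>Pow {1..N}. pmf (obs A) Y)"
      unfolding sum.distrib[symmetric] by (intro sum.cong) auto
    ultimately show ?thesis using sum_pmf_observation[OF family(1)[OF A], of p] by simp
  qed
  have "r * (1 - \<theta>) = r * ((\<Sum>A\<in>\<F>. pmf \<pi> A) * (1 - \<theta>))"
    using \<pi> by (simp add: sum_pmf_eq_1)
  also have "\<dots> \<le> r * (\<Sum>A\<in>\<F>. pmf \<pi> A * (\<Sum>Y\<in>Pow {1..N}. pmf (obs A) Y * of_bool (good A Y)))"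
    unfolding sum_distrib_right using r prob_good by (intro mult_left_mono sum_mono) auto
  also have "\<dots> = (\<Sum>A\<in>\<F>. \<Sum>Y\<in>Pow {1..N}. joint \<pi> Y A * (r * of_bool (good A Y)))"
    unfolding joint_def sum_distrib_left by (intro sum.cong refl) simp
  also have "\<dots> = (\<Sum>Y\<in>Pow {1..N}. \<Sum>A\<in>\<F>. joint \<pi> Y A * (r * of_bool (good A Y)))"
    by (rule sum.swap)
  also have "\<dots> \<le> overlap \<pi>"
    unfolding overlap_def
  proof (intro sum_mono)
    fix Y A assume A: "A \<in> \<F>"
    show "joint \<pi> Y A * (r * of_bool (good A Y)) \<le>
      (\<Sum>A'\<in>\<F>. joint \<pi> Y A * joint \<pi> Y A' / sum (joint \<pi> Y) \<F> * card (A \<inter> A'))"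
    proof (cases "good A Y \<and> joint \<pi> Y A \<noteq> 0")
      case True
      have "0 < joint \<pi> Y A" using True by (simp add: less_le)
      then have pos: "0 < sum (joint \<pi> Y) \<F>" using A by (intro sum_pos2[of _ A]) auto
      then have "joint \<pi> Y A * (r * of_bool (good A Y)) =
          (\<Sum>A'\<in>\<F>. joint \<pi> Y A * joint \<pi> Y A' / sum (joint \<pi> Y) \<F>) * r"
        using True by (simp flip: sum_distrib_left sum_divide_distrib)
      also have "\<dots> \<le> (\<Sum>A'\<in>\<F>. joint \<pi> Y A * joint \<pi> Y A' / sum (joint \<pi> Y) \<F> * card (A \<inter> A'))"
        unfolding sum_distrib_right
      proof (rule sum_mono)
        fix A' assume A': "A' \<in> \<F>"
        show "joint \<pi> Y A * joint \<pi> Y A' / sum (joint \<pi> Y) \<F> * r \<le>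
            joint \<pi> Y A * joint \<pi> Y A' / sum (joint \<pi> Y) \<F> * card (A \<inter> A')"
        proof (cases "joint \<pi> Y A' = 0")
          case False
          then have "r \<le> card (A \<inter> A')"
            using True joint_nonzero_imp_subset[OF A'] A' by (auto simp: good_def)
          then show ?thesis using pos by (intro mult_left_mono) auto
        qed simp
      qed
      finally show ?thesis .
    next
      case False
      then have "joint \<pi> Y A * (r * of_bool (good A Y)) = 0" by auto
      also have "0 \<le> (\<Sum>A'\<in>\<F>. joint \<pi> Y A * joint \<pi> Y A' / sum (joint \<pi> Y) \<F> * card (A \<inter> A'))"
        by (auto intro!: sum_nonneg mult_nonneg_nonneg divide_nonneg_nonneg)
      finally show ?thesis .
    qed
  qed
  finally show ?thesis .
qed

text \<open>The overlap is nonnegative. This bound serves the case where \<open>q\<close> is below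
  the tolerance \<open>d\<close>, which \<open>MinMax_le\<close> does not cover.\<close>

lemma MinMax_le_1: "MinMax N k \<F> p \<le> 1"
  unfolding MinMax_def
  by (rule SUP_least) (auto simp: MMSE_eq overlap_nonneg intro!: ennreal_le_1[THEN iffD2])

text \<open>For every admissible \<open>S\<close>, the strict inequality yields a weight of cost at
  most 1/2 at some point above \<open>L * p\<close>, and monotonicity brings it down to
  \<open>L * p\<close>. These weights depend only on the family, so the overlap bound holds for all
  priors at once.\<close>

lemma MinMax_le:
  fixes q d L \<theta> :: real
  assumes L: "1 \<le> L" and d: "0 \<le> d" "d \<le> q"
    and decay: "\<And>n. d * k \<le> real n \<Longrightarrow> 2 ^ k * (1 / L) ^ n \<le> \<theta>"
    and psi: "ennreal (L * p) < psi N k \<F> q"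
  shows "MinMax N k \<F> p \<le> ennreal (1 - (q - d) * (1 - \<theta>))"
proof -
  have "\<exists>w. w \<in> weights N k \<F> q S \<and> weight_poly N S w (L * p) \<le> 1 / 2"
    if S: "S \<subseteq> {1..N}" "card S \<le> q * k" for S
  proof -
    have "ennreal (L * p) < (SUP w\<in>weights N k \<F> q S. half_point N S w)"
      using psi S unfolding psi_def by (auto intro: less_le_trans INF_lower)
    then obtain w where w: "w \<in> weights N k \<F> q S" "ennreal (L * p) < half_point N S w"
      by (auto simp: less_SUP_iff)
    then obtain x where "0 \<le> x" "weight_poly N S w x \<le> 1 / 2" "ennreal (L * p) < ennreal x"
      by (auto simp: half_point_def less_SUP_iff)
    then show ?thesis
      using w(1) weight_poly_mono[OF w(1), of "L * p" x] L p by (auto simp: ennreal_less_iff)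
  qed
  then obtain w where w: "\<And>S. S \<subseteq> {1..N} \<Longrightarrow> card S \<le> q * k \<Longrightarrow>
      w S \<in> weights N k \<F> q S \<and> weight_poly N S (w S) (L * p) \<le> 1 / 2"
    by metis
  show ?thesis
    unfolding MinMax_def
  proof (rule SUP_least)
    fix \<pi> assume \<pi>: "\<pi> \<in> {\<pi>. set_pmf \<pi> \<subseteq> \<F>}"
    have "(q - d) * k * (1 - \<theta>) \<le> overlap \<pi>"
      using \<pi> d prob_small_overlap_le[OF _ L d(1) decay w] by (intro overlap_ge) auto
    then have "(q - d) * (1 - \<theta>) \<le> overlap \<pi> / k" using k by (simp add: field_simps)
    then show "MMSE N k p \<pi> \<le> ennreal (1 - (q - d) * (1 - \<theta>))"
      using \<pi> by (simp add: MMSE_eq ennreal_leI)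
  qed
qed

section \<open>Overlap above the threshold\<close>

text \<open>
  Multiplied out by the law of \<open>S \<union> X\<close>, so that no division by zero can occur.
\<close>

lemma pmf_observation_mult:
  assumes "S \<subseteq> A" "S \<subseteq> A'" "A \<subseteq> {1..N}" "A' \<subseteq> {1..N}"
  shows "pmf (obs A) Y * pmf (obs A') Y * p ^ card (A \<inter> A' - S) =
    pmf (obs S) Y * pmf (obs (A \<union> A')) Y"
proof (cases "A \<union> A' \<subseteq> Y \<and> Y \<subseteq> {1..N}")
  case True
  then have fin: "finite Y" by (auto intro: finite_subset)
  have S_sub: "S \<subseteq> {1..N}" using assms by auto
  have "card (Y - A) + card (Y - A') = card (Y - A \<inter> A') + card (Y - (A \<union> A'))"
    using card_Un_Int[of "Y - A" "Y - A'"] fin by (simp add: Diff_Int Diff_Un)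
  moreover have "card (Y - S) = card (Y - A \<inter> A') + card (A \<inter> A' - S)"
  proof -
    have "Y - S = (Y - A \<inter> A') \<union> (A \<inter> A' - S)" using True assms by auto
    also have "card \<dots> = card (Y - A \<inter> A') + card (A \<inter> A' - S)"
      using fin True by (intro card_Un_disjoint) (auto intro: finite_subset[of _ Y])
    finally show ?thesis .
  qed
  \<comment> \<open>Each of the four laws contributes the exponent \<open>card ({1..N} - Y)\<close>
    of \<open>1 - p\<close>, so only the powers of \<open>p\<close> need comparing.\<close>
  ultimately have "p ^ card (Y - A) * p ^ card (Y - A') * p ^ card (A \<inter> A' - S) =
      p ^ card (Y - S) * p ^ card (Y - (A \<union> A'))"
    by (simp add: ac_simps flip: power_add)
  then show ?thesis
    using True assms S_sub p by (auto simp: pmf_observation mult_ac)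
next
  case False
  then show ?thesis using assms p by (auto simp: pmf_observation)
qed

text \<open>
  Where the likelihood ratio of the law of \<open>Y\<close> to that of \<open>S \<union> X\<close> is
  below \<open>\<epsilon>\<close>, the law of \<open>Y\<close> has total mass at most \<open>\<epsilon>\<close>; elsewhere the normalising constant of
  the posterior is replaced by its lower bound.
\<close>

lemma overlap_le:
  fixes r \<epsilon> \<eta> :: real
  assumes \<pi>: "set_pmf \<pi> \<subseteq> {A \<in> \<F>. S \<subseteq> A}" and S: "S \<subseteq> {1..N}" and \<epsilon>: "0 < \<epsilon>" and r: "0 \<le> r"
    and \<eta>: "\<And>A. A \<in> \<F> \<Longrightarrow> S \<subseteq> A \<Longrightarrow>
      (\<Sum>A'\<in>\<F>. pmf \<pi> A' * ((1 / p) ^ card (A \<inter> A' - S) * of_bool (r < card (A \<inter> A')))) \<le> \<eta>"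
  shows "overlap \<pi> \<le> r + k * \<epsilon> + k * \<eta> / \<epsilon>"
proof -
  define big where "big A A' = (of_bool (r < card (A \<inter> A')) :: real)" for A A' :: "nat set"
  have big: "0 \<le> big A A'" for A A' by (simp add: big_def)
  define Z where "Z Y = sum (joint \<pi> Y) \<F>" for Y
  have Z_nonneg: "0 \<le> Z Y" for Y by (simp add: Z_def sum_nonneg)
  define Q where "Q Y = pmf (obs S) Y" for Y
  have Q_nonneg: "0 \<le> Q Y" for Y by (simp add: Q_def)
  have \<pi>_F: "set_pmf \<pi> \<subseteq> \<F>" using \<pi> by auto
  have overlap_Y: "(\<Sum>A\<in>\<F>. \<Sum>A'\<in>\<F>. joint \<pi> Y A * joint \<pi> Y A' / Z Y * card (A \<inter> A')) \<le>
      k * \<epsilon> * Q Y + r * Z Y +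
      (k / \<epsilon>) * (\<Sum>A\<in>\<F>. \<Sum>A'\<in>\<F>. big A A' * (joint \<pi> Y A * joint \<pi> Y A' / Q Y))"
    (is "?lhs \<le> ?b1 + ?b2 + ?b3") for Y
  proof -
    have b: "0 \<le> ?b1" "0 \<le> ?b2" "0 \<le> ?b3"
      using \<epsilon> r k Z_nonneg Q_nonneg big by (auto intro!: mult_nonneg_nonneg sum_nonneg divide_nonneg_nonneg)
    have card_le: "card (A \<inter> A') \<le> k" if "A \<in> \<F>" for A A'
      using card_mono[of A "A \<inter> A'"] family[OF that] finite_subset by fastforce
    \<comment> \<open>Summing both samples of the posterior leaves the mass of \<open>Y\<close>; if
      \<open>Z Y = 0\<close>, both sides vanish.\<close>
    have ZZ: "(\<Sum>A\<in>\<F>. \<Sum>A'\<in>\<F>. joint \<pi> Y A * joint \<pi> Y A' / Z Y * c) = Z Y * c" for c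
    proof -
      have "(\<Sum>A\<in>\<F>. \<Sum>A'\<in>\<F>. joint \<pi> Y A * joint \<pi> Y A' / Z Y * c) = Z Y * Z Y / Z Y * c"
      proof -
        have "Z Y * Z Y = (\<Sum>A\<in>\<F>. \<Sum>A'\<in>\<F>. joint \<pi> Y A * joint \<pi> Y A')"
          by (simp only: Z_def sum_product)
        then show ?thesis by (simp only: sum_divide_distrib sum_distrib_right)
      qed
      then show ?thesis by simp
    qed
    show ?thesis
    proof (cases "Z Y < \<epsilon> * Q Y")
      case True
      have "?lhs \<le> (\<Sum>A\<in>\<F>. \<Sum>A'\<in>\<F>. joint \<pi> Y A * joint \<pi> Y A' / Z Y * k)"
        using card_le Z_nonneg by (intro sum_mono mult_left_mono) auto
      also have "\<dots> \<le> ?b1" unfolding ZZ using True k by (simp add: algebra_simps)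
      finally show ?thesis using b by linarith
    next
      case False
      have "?lhs \<le> (\<Sum>A\<in>\<F>. \<Sum>A'\<in>\<F>. joint \<pi> Y A * joint \<pi> Y A' / Z Y * r +
          k / \<epsilon> * (big A A' * (joint \<pi> Y A * joint \<pi> Y A' / Q Y)))"
      proof (intro sum_mono)
        fix A A' assume A: "A \<in> \<F>" and A': "A' \<in> \<F>"
        define jj where "jj = joint \<pi> Y A * joint \<pi> Y A'"
        have jj: "0 \<le> jj" by (simp add: jj_def)
        show "jj / Z Y * card (A \<inter> A') \<le> jj / Z Y * r + k / \<epsilon> * (big A A' * (jj / Q Y))"
        proof (cases "r < card (A \<inter> A') \<and> jj \<noteq> 0")
          case True
          then have "A \<in> set_pmf \<pi>" "joint \<pi> Y A \<noteq> 0" by (auto simp: jj_def joint_def set_pmf_iff)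
          \<comment> \<open>A nonzero joint probability gives
            \<open>S \<subseteq> A \<subseteq> Y\<close>, so the reference mass \<open>Q Y\<close>
            is positive and may be divided by.\<close>
          then have "S \<subseteq> Y" "Y \<subseteq> {1..N}"
            using \<pi> A p by (auto simp: joint_def pmf_observation family(1) split: if_splits)
          then have Q: "0 < Q Y" using S p by (simp add: Q_def pmf_observation)
          have "jj / Z Y \<le> jj / (\<epsilon> * Q Y)"
            using False Q \<epsilon> jj by (intro divide_left_mono) (auto intro!: mult_pos_pos less_le_trans[of 0 "\<epsilon> * Q Y" "Z Y"])
          then have "jj / Z Y * card (A \<inter> A') \<le> jj / (\<epsilon> * Q Y) * k"
            using card_le[OF A] jj Q \<epsilon> by (intro mult_mono) auto
          also have "\<dots> = k / \<epsilon> * (big A A' * (jj / Q Y))" using True by (simp add: big_def)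
          finally show ?thesis using jj r Z_nonneg by (simp add: add_increasing)
        next
          case not_big: False
          have "jj / Z Y * card (A \<inter> A') \<le> jj / Z Y * r"
            using not_big jj Z_nonneg[of Y]
            by (cases "jj = 0") (auto intro!: mult_left_mono divide_right_mono)
          moreover have "0 \<le> k / \<epsilon> * (big A A' * (jj / Q Y))"
            using \<epsilon> jj Q_nonneg big by simp
          ultimately show ?thesis by linarith
        qed
      qed
      also have "\<dots> = ?b2 + ?b3"
        by (simp only: sum.distrib ZZ sum_distrib_left mult.commute[of r])
      finally show ?thesis using b by linarith
    qed
  qed
  \<comment> \<open>The likelihood ratios of two members have correlation
    \<open>(1 / p) ^ card (A \<inter> A' - S)\<close> under the law of \<open>S \<union> X\<close>,
    because \<open>obs (A \<union> A')\<close> sums to 1. Terms with \<open>Q Y = 0\<close> count as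
    0 on the left, hence the inequality.\<close>
  have pair: "(\<Sum>Y\<in>Pow {1..N}. joint \<pi> Y A * joint \<pi> Y A' / Q Y) \<le>
      pmf \<pi> A * (pmf \<pi> A' * (1 / p) ^ card (A \<inter> A' - S))" if A: "A \<in> \<F>" "A' \<in> \<F>" for A A'
  proof (cases "A \<in> set_pmf \<pi> \<and> A' \<in> set_pmf \<pi>")
    case True
    then have S_sub: "S \<subseteq> A" "S \<subseteq> A'" using \<pi> by auto
    have "joint \<pi> Y A * joint \<pi> Y A' / Q Y \<le>
        pmf \<pi> A * (pmf \<pi> A' * (1 / p) ^ card (A \<inter> A' - S)) * pmf (obs (A \<union> A')) Y" for Y
    proof (cases "Q Y = 0")
      case False
      then show ?thesis
        using pmf_observation_mult[OF S_sub family(1)[OF A(1)] family(1)[OF A(2)], of Y] p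
        by (simp add: joint_def Q_def field_simps)
    qed (use p in simp)
    then have "(\<Sum>Y\<in>Pow {1..N}. joint \<pi> Y A * joint \<pi> Y A' / Q Y) \<le>
        pmf \<pi> A * (pmf \<pi> A' * (1 / p) ^ card (A \<inter> A' - S)) *
        (\<Sum>Y\<in>Pow {1..N}. pmf (obs (A \<union> A')) Y)"
      unfolding sum_distrib_left by (rule sum_mono)
    then show ?thesis using A family(1) by (simp add: sum_pmf_observation)
  next
    case False
    then have "joint \<pi> Y A * joint \<pi> Y A' / Q Y = 0" for Y by (auto simp: joint_def set_pmf_iff)
    then show ?thesis using p by (simp only: sum.neutral_const) simp
  qed
  have "(\<Sum>Y\<in>Pow {1..N}. \<Sum>A\<in>\<F>. \<Sum>A'\<in>\<F>. big A A' * (joint \<pi> Y A * joint \<pi> Y A' / Q Y)) =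
      (\<Sum>A\<in>\<F>. \<Sum>A'\<in>\<F>. big A A' * (\<Sum>Y\<in>Pow {1..N}. joint \<pi> Y A * joint \<pi> Y A' / Q Y))"
    unfolding sum_distrib_left by (rule trans[OF sum.swap], rule sum.cong[OF refl], rule sum.swap)
  also have "\<dots> \<le> (\<Sum>A\<in>\<F>. \<Sum>A'\<in>\<F>. big A A' * (pmf \<pi> A * (pmf \<pi> A' * (1 / p) ^ card (A \<inter> A' - S))))"
    using pair big by (intro sum_mono mult_left_mono) auto
  also have "\<dots> = (\<Sum>A\<in>\<F>. pmf \<pi> A *
      (\<Sum>A'\<in>\<F>. pmf \<pi> A' * ((1 / p) ^ card (A \<inter> A' - S) * of_bool (r < card (A \<inter> A')))))"
    unfolding sum_distrib_left big_def by (intro sum.cong refl) (simp only: mult_ac)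
  also have "\<dots> \<le> (\<Sum>A\<in>\<F>. pmf \<pi> A * \<eta>)"
  proof (rule sum_mono)
    fix A assume A: "A \<in> \<F>"
    show "pmf \<pi> A * (\<Sum>A'\<in>\<F>. pmf \<pi> A' * ((1 / p) ^ card (A \<inter> A' - S) * of_bool (r < card (A \<inter> A'))))
        \<le> pmf \<pi> A * \<eta>"
    proof (cases "A \<in> set_pmf \<pi>")
      case True
      then show ?thesis using \<eta>[OF A] \<pi> by (intro mult_left_mono) auto
    qed (simp add: set_pmf_iff)
  qed
  also have "\<dots> = \<eta>" using \<pi>_F by (simp add: sum_pmf_eq_1 flip: sum_distrib_right)
  finally have big_le: "(\<Sum>Y\<in>Pow {1..N}. \<Sum>A\<in>\<F>. \<Sum>A'\<in>\<F>. big A A' * (joint \<pi> Y A * joint \<pi> Y A' / Q Y)) \<le> \<eta>" .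
  have "overlap \<pi> \<le> (\<Sum>Y\<in>Pow {1..N}. k * \<epsilon> * Q Y + r * Z Y +
      (k / \<epsilon>) * (\<Sum>A\<in>\<F>. \<Sum>A'\<in>\<F>. big A A' * (joint \<pi> Y A * joint \<pi> Y A' / Q Y)))"
    unfolding overlap_def using overlap_Y by (intro sum_mono) (simp add: Z_def)
  also have "\<dots> = k * \<epsilon> + r + (k / \<epsilon>) *
      (\<Sum>Y\<in>Pow {1..N}. \<Sum>A\<in>\<F>. \<Sum>A'\<in>\<F>. big A A' * (joint \<pi> Y A * joint \<pi> Y A' / Q Y))"
  proof -
    have "(\<Sum>Y\<in>Pow {1..N}. Q Y) = 1" "(\<Sum>Y\<in>Pow {1..N}. Z Y) = 1"
      using sum_pmf_observation[OF S, of p] sum_joint[OF \<pi>_F] by (simp_all add: Q_def Z_def)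
    then show ?thesis by (simp only: sum.distrib sum_distrib_left[symmetric] mult_1_right)
  qed
  also have "\<dots> \<le> k * \<epsilon> + r + (k / \<epsilon>) * \<eta>"
    using big_le \<epsilon> by (intro add_left_mono mult_left_mono) auto
  finally show ?thesis by simp
qed

text \<open>
  If no fractional cover of the members above \<open>S\<close> costs at most \<open>1/2\<close>, linear programming
  duality gives a spread prior: a column strategy winning against \<open>v = 2\<close> would, after
  rescaling and truncation at \<open>1\<close>, be such a cover.
\<close>

lemma spread_prior_exists:
  fixes q x :: real
  assumes x: "0 < x" and S: "S \<subseteq> {1..N}"
    and cost: "\<And>w. w \<in> weights N k \<F> q S \<Longrightarrow> 1 / 2 < weight_poly N S w x"
  obtains \<pi> where "set_pmf \<pi> \<subseteq> {A \<in> \<F>. S \<subseteq> A}"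
    and "\<And>T. T \<subseteq> {1..N} \<Longrightarrow> S \<subseteq> T \<Longrightarrow> q * k \<le> card T \<Longrightarrow>
      (\<Sum>A\<in>\<F>. pmf \<pi> A * of_bool (T \<subseteq> A)) \<le> 2 * x ^ card (T - S)"
proof -
  define I where "I = {A \<in> \<F>. S \<subseteq> A}"
  define J where "J = {T. T \<subseteq> {1..N} \<and> S \<subseteq> T \<and> q * k \<le> card T}"
  define M where "M A T = of_bool (T \<subseteq> A) / x ^ card (T - S)" for A T :: "nat set"
  have fin_I: "finite I" by (simp add: I_def)
  have fin_J: "finite J" by (rule finite_subset[of _ "Pow {1..N}"]) (auto simp: J_def)
  have I_ne: "I \<noteq> {}"
  proof
    assume "I = {}"
    \<comment> \<open>With no member to cover, the zero weight would be admissible at cost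
      0.\<close>
    then have "(\<lambda>_. 0) \<in> weights N k \<F> q S" by (auto simp: weights_def I_def)
    from cost[OF this] show False by (simp add: weight_poly_def)
  qed
  show thesis
  proof (rule matrix_game_alternative[OF fin_I I_ne fin_J, where M = M and v = 2])
    fix u assume row: "\<And>A. 0 \<le> u A" "\<And>A. A \<notin> I \<Longrightarrow> u A = 0" "sum u I = 1"
      "\<And>T. T \<in> J \<Longrightarrow> (\<Sum>A\<in>I. u A * M A T) \<le> 2"
    have u_I: "A \<in> I" if "u A \<noteq> 0" for A using row(2) that by blast
    define \<pi> where "\<pi> = embed_pmf u"
    have "(\<integral>\<^sup>+ A. ennreal (u A) \<partial>count_space UNIV) = (\<integral>\<^sup>+ A. ennreal (u A) \<partial>count_space I)"
      using row(2) by (intro nn_integral_count_space_eq) auto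
    also have "\<dots> = 1" using row(1,3) fin_I by (simp add: nn_integral_count_space_finite sum_ennreal)
    finally have pmf_\<pi>: "pmf \<pi> A = u A" for A
      unfolding \<pi>_def by (intro pmf_embed_pmf row(1))
    show thesis
    proof (rule that)
      show "set_pmf \<pi> \<subseteq> {A \<in> \<F>. S \<subseteq> A}"
        using u_I by (fastforce simp: set_pmf_iff pmf_\<pi> I_def)
      fix T assume T: "T \<subseteq> {1..N}" "S \<subseteq> T" "q * k \<le> card T"
      have "(\<Sum>A\<in>\<F>. pmf \<pi> A * of_bool (T \<subseteq> A)) = (\<Sum>A\<in>I. u A * of_bool (T \<subseteq> A))"
        unfolding pmf_\<pi> using u_I by (intro sum.mono_neutral_right) (auto simp: I_def)
      also have "\<dots> = (\<Sum>A\<in>I. u A * M A T) * x ^ card (T - S)"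
        unfolding sum_distrib_right using x by (intro sum.cong refl) (simp add: M_def)
      also have "\<dots> \<le> 2 * x ^ card (T - S)"
        using row(4)[of T] T x by (intro mult_right_mono) (auto simp: J_def)
      finally show "(\<Sum>A\<in>\<F>. pmf \<pi> A * of_bool (T \<subseteq> A)) \<le> 2 * x ^ card (T - S)" .
    qed
  next
    fix y assume col: "\<And>T. 0 \<le> y T" "\<And>A. A \<in> I \<Longrightarrow> 2 * sum y J < (\<Sum>T\<in>J. y T * M A T)"
    \<comment> \<open>Otherwise \<open>y\<close> vanishes on \<open>J\<close>, and the strict
      inequality at any member of \<open>I\<close> reads 0 < 0.\<close>
    have s: "0 < sum y J"
    proof (rule ccontr)
      assume "\<not> 0 < sum y J"
      then have "sum y J = 0" using col(1) sum_nonneg[of J y] by fastforce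
      then have "y T = 0" if "T \<in> J" for T
        using that col(1) fin_J sum_nonneg_eq_0_iff[of J y] by auto
      then show False using col(2) I_ne by fastforce
    qed
    \<comment> \<open>The scaling makes the cost of \<open>c\<close> over \<open>J\<close> at
      \<open>x\<close> exactly 1/2, while a value above 2 makes \<open>c\<close> sum to more than 1
      over the sets of \<open>J\<close> inside any member of \<open>I\<close>.\<close>
    define c where "c T = y T / (2 * sum y J * x ^ card (T - S))" for T
    define w where "w T = (if T \<in> J then min 1 (c T) else 0)" for T
    have c_nonneg: "0 \<le> c T" for T using col(1)[of T] s x by (simp add: c_def)
    have w_nonneg: "0 \<le> w T" for T using c_nonneg by (simp add: w_def)
    have "1 \<le> (\<Sum>T\<in>Pow A. w T)" if A: "A \<in> I" for A
    proof -
      have A_sub: "A \<subseteq> {1..N}" using A family(1) by (simp add: I_def)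
      then have fin_A: "finite A" by (rule finite_subset) simp
      show ?thesis
      \<comment> \<open>A single set truncated at 1 already covers \<open>A\<close>; if there is
        none, \<open>w\<close> and \<open>c\<close> agree on the sets of \<open>J\<close> inside
        \<open>A\<close>.\<close>
      proof (cases "\<exists>T\<in>Pow A \<inter> J. 1 \<le> c T")
        case True
        then obtain T where "T \<in> Pow A" "w T = 1" by (auto simp: w_def)
        then show ?thesis using member_le_sum[of T "Pow A" w] w_nonneg fin_A by simp
      next
        case False
        have "2 * sum y J < (\<Sum>T\<in>J. y T * M A T)" by (rule col(2)[OF A])
        also have "\<dots> = (\<Sum>T\<in>Pow A \<inter> J. y T * M A T)"
          using fin_J by (intro sum.mono_neutral_right) (auto simp: M_def)
        also have "\<dots> = 2 * sum y J * (\<Sum>T\<in>Pow A \<inter> J. w T)"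
          unfolding sum_distrib_left[of "2 * sum y J"]
        proof (rule sum.cong[OF refl])
          fix T assume T: "T \<in> Pow A \<inter> J"
          then have "w T = c T" using False by (auto simp: w_def min_def)
          then show "y T * M A T = 2 * sum y J * w T" using T s by (simp add: c_def M_def)
        qed
        also have "(\<Sum>T\<in>Pow A \<inter> J. w T) \<le> (\<Sum>T\<in>Pow A. w T)"
          using fin_A w_nonneg by (intro sum_mono2) auto
        finally show ?thesis using s by simp
      qed
    qed
    then have "w \<in> weights N k \<F> q S"
      using c_nonneg by (auto simp: weights_def I_def w_def J_def)
    then have "1 / 2 < weight_poly N S w x" by (rule cost)
    also have "\<dots> = (\<Sum>T\<in>J. w T * x ^ card (T - S))"
      unfolding weight_poly_def by (rule sum.mono_neutral_right) (auto simp: J_def w_def)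
    also have "\<dots> \<le> (\<Sum>T\<in>J. y T / (2 * sum y J))"
    proof (rule sum_mono)
      fix T assume "T \<in> J"
      then have "w T * x ^ card (T - S) \<le> c T * x ^ card (T - S)"
        using x by (intro mult_right_mono) (auto simp: w_def)
      then show "w T * x ^ card (T - S) \<le> y T / (2 * sum y J)" using x by (simp add: c_def)
    qed
    also have "\<dots> = 1 / 2" using s by (simp flip: sum_divide_distrib)
    finally show thesis by simp
  qed
qed

text \<open>A witness \<open>S\<close> for the infimum has no cover of cost at most 1/2 at
  \<open>p / L\<close>, hence a spread prior. In the second moment
  \<open>(1 / p) ^ card (T - S)\<close> meets at most \<open>2 * (p / L) ^ card (T - S)\<close>, so
  the powers of \<open>p\<close> cancel and \<open>decay\<close> absorbs the at most
  \<open>2 ^ k\<close> sets \<open>T\<close>.\<close>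

lemma MinMax_ge:
  fixes q d L \<theta> \<epsilon> :: real
  assumes L: "1 \<le> L" and q: "0 \<le> q" and d: "0 \<le> d" and \<epsilon>: "0 < \<epsilon>"
    and decay: "\<And>n. d * k \<le> real n \<Longrightarrow> 2 ^ k * (1 / L) ^ n \<le> \<theta>"
    and psi: "psi N k \<F> q < ennreal (p / L)"
  shows "ennreal (1 - (q + d + \<epsilon> + 2 * \<theta> / \<epsilon>)) \<le> MinMax N k \<F> p"
proof -
  obtain S where S: "S \<subseteq> {1..N}" "card S \<le> q * k"
    and S_psi: "(SUP w\<in>weights N k \<F> q S. half_point N S w) < ennreal (p / L)"
    using psi by (auto simp: psi_def INF_less_iff)
  have x: "0 < p / L" using p L by simp
  have "1 / 2 < weight_poly N S w (p / L)" if w: "w \<in> weights N k \<F> q S" for w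
  proof (rule ccontr)
    assume "\<not> 1 / 2 < weight_poly N S w (p / L)"
    then have "ennreal (p / L) \<le> half_point N S w"
      unfolding half_point_def using x by (intro SUP_upper) auto
    also have "\<dots> \<le> (SUP w\<in>weights N k \<F> q S. half_point N S w)" by (rule SUP_upper[OF w])
    finally show False using S_psi by simp
  qed
  then obtain \<pi> where \<pi>: "set_pmf \<pi> \<subseteq> {A \<in> \<F>. S \<subseteq> A}"
    and spread: "\<And>T. T \<subseteq> {1..N} \<Longrightarrow> S \<subseteq> T \<Longrightarrow> q * k \<le> card T \<Longrightarrow>
      (\<Sum>A\<in>\<F>. pmf \<pi> A * of_bool (T \<subseteq> A)) \<le> 2 * (p / L) ^ card (T - S)"
    using spread_prior_exists[OF x S(1)] by blast
  have \<pi>_F: "set_pmf \<pi> \<subseteq> \<F>" using \<pi> by auto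
  have fin_S: "finite S" using S(1) by (rule finite_subset) simp
  have "(\<Sum>A'\<in>\<F>. pmf \<pi> A' * ((1 / p) ^ card (A \<inter> A' - S) * of_bool ((q + d) * k < card (A \<inter> A'))))
      \<le> 2 * \<theta>" if A: "A \<in> \<F>" "S \<subseteq> A" for A
  proof -
    \<comment> \<open>The possible large intersections \<open>A \<inter> A'\<close>. Relaxing
      equality with \<open>T\<close> to \<open>T \<subseteq> A'\<close> turns the sum over
      \<open>A'\<close> into the probabilities bounded by \<open>spread\<close>.\<close>
    define \<T> where "\<T> = {T. S \<subseteq> T \<and> T \<subseteq> A \<and> (q + d) * k < card T}"
    have fin_A: "finite A" using family(1)[OF A(1)] by (rule finite_subset) simp
    have fin_\<T>: "finite \<T>" using fin_A by (auto simp: \<T>_def)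
    have "(\<Sum>A'\<in>\<F>. pmf \<pi> A' * ((1 / p) ^ card (A \<inter> A' - S) * of_bool ((q + d) * k < card (A \<inter> A'))))
        \<le> (\<Sum>A'\<in>\<F>. pmf \<pi> A' * (\<Sum>T\<in>\<T>. (1 / p) ^ card (T - S) * of_bool (T \<subseteq> A')))"
    proof (rule sum_mono)
      fix A' assume A': "A' \<in> \<F>"
      show "pmf \<pi> A' * ((1 / p) ^ card (A \<inter> A' - S) * of_bool ((q + d) * k < card (A \<inter> A')))
        \<le> pmf \<pi> A' * (\<Sum>T\<in>\<T>. (1 / p) ^ card (T - S) * of_bool (T \<subseteq> A'))"
      proof (cases "A' \<in> set_pmf \<pi> \<and> (q + d) * k < card (A \<inter> A')")
        case True
        then have "A \<inter> A' \<in> \<T>" using \<pi> A by (auto simp: \<T>_def)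
        then have "(1 / p) ^ card (A \<inter> A' - S) * of_bool (A \<inter> A' \<subseteq> A') \<le>
            (\<Sum>T\<in>\<T>. (1 / p) ^ card (T - S) * of_bool (T \<subseteq> A'))"
          using p fin_\<T> by (intro member_le_sum[of _ _ "\<lambda>T. (1 / p) ^ card (T - S) * of_bool (T \<subseteq> A')"]) auto
        then show ?thesis using True by (intro mult_left_mono) auto
      next
        case False
        then have "pmf \<pi> A' * ((1 / p) ^ card (A \<inter> A' - S) * of_bool ((q + d) * k < card (A \<inter> A'))) = 0"
          by (auto simp: set_pmf_iff)
        also have "0 \<le> pmf \<pi> A' * (\<Sum>T\<in>\<T>. (1 / p) ^ card (T - S) * of_bool (T \<subseteq> A'))"
          using p by (intro mult_nonneg_nonneg sum_nonneg) auto
        finally show ?thesis .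
      qed
    qed
    also have "\<dots> = (\<Sum>T\<in>\<T>. (1 / p) ^ card (T - S) * (\<Sum>A'\<in>\<F>. pmf \<pi> A' * of_bool (T \<subseteq> A')))"
      unfolding sum_distrib_left by (subst sum.swap) (simp only: mult_ac)
    also have "\<dots> \<le> (\<Sum>T\<in>\<T>. 2 * \<theta> / 2 ^ k)"
    proof (rule sum_mono)
      fix T assume T: "T \<in> \<T>"
      have "T \<subseteq> {1..N}" "S \<subseteq> T" using T family(1)[OF A(1)] by (auto simp: \<T>_def)
      moreover have big: "q * k + d * k < card T" using T by (auto simp: \<T>_def algebra_simps)
      moreover have "0 \<le> d * k" using d by simp
      ultimately have "(\<Sum>A'\<in>\<F>. pmf \<pi> A' * of_bool (T \<subseteq> A')) \<le> 2 * (p / L) ^ card (T - S)"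
        by (intro spread) auto
      then have "(1 / p) ^ card (T - S) * (\<Sum>A'\<in>\<F>. pmf \<pi> A' * of_bool (T \<subseteq> A')) \<le>
          (1 / p) ^ card (T - S) * (2 * (p / L) ^ card (T - S))"
        using p by (intro mult_left_mono) auto
      also have "\<dots> = 2 * (1 / L) ^ card (T - S)" using p by (simp add: power_divide)
      also have "\<dots> \<le> 2 * \<theta> / 2 ^ k"
      proof -
        have "card (T - S) = card T - card S" "card S \<le> card T"
          using fin_S \<open>S \<subseteq> T\<close> \<open>T \<subseteq> {1..N}\<close> by (auto simp: card_Diff_subset card_mono finite_subset)
        then have "d * k \<le> card (T - S)" using big S(2) by (simp add: of_nat_diff)
        then have "2 ^ k * (1 / L) ^ card (T - S) \<le> \<theta>" by (rule decay)
        then show ?thesis by (simp add: field_simps)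
      qed
      finally show "(1 / p) ^ card (T - S) * (\<Sum>A'\<in>\<F>. pmf \<pi> A' * of_bool (T \<subseteq> A')) \<le> 2 * \<theta> / 2 ^ k" .
    qed
    also have "\<dots> = card \<T> * (2 * \<theta> / 2 ^ k)" by simp
    also have "\<dots> \<le> 2 ^ k * (2 * \<theta> / 2 ^ k)"
    proof (rule mult_right_mono)
      have "card \<T> \<le> card (Pow A)" using fin_A by (intro card_mono) (auto simp: \<T>_def)
      then show "real (card \<T>) \<le> 2 ^ k"
        using fin_A family(2)[OF A(1)] by (simp add: card_Pow flip: of_nat_le_iff)
      have "0 \<le> 2 ^ k * (1 / L) ^ nat \<lceil>d * k\<rceil>" using L by simp
      also have "\<dots> \<le> \<theta>" by (rule decay) linarith
      finally show "0 \<le> 2 * \<theta> / 2 ^ k" by simp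
    qed
    finally show ?thesis by simp
  qed
  then have "overlap \<pi> \<le> (q + d) * k + k * \<epsilon> + k * (2 * \<theta>) / \<epsilon>"
    using q d by (intro overlap_le[OF \<pi> S(1) \<epsilon>]) auto
  then have "overlap \<pi> / k \<le> q + d + \<epsilon> + 2 * \<theta> / \<epsilon>"
    using k by (simp add: field_simps)
  then have "ennreal (1 - (q + d + \<epsilon> + 2 * \<theta> / \<epsilon>)) \<le> MMSE N k p \<pi>"
    by (simp add: MMSE_eq[OF \<pi>_F] ennreal_leI)
  also have "\<dots> \<le> MinMax N k \<F> p"
    unfolding MinMax_def using \<pi>_F by (intro SUP_upper) simp
  finally show ?thesis .
qed

end

section \<open>Asymptotics\<close>

text \<open>\<open>L\<close> solves \<open>L powr d = 2 / \<theta>\<close>, so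
  \<open>L ^ n \<ge> (2 / \<theta>) ^ k\<close> and the product is at most
  \<open>\<theta> ^ k \<le> \<theta>\<close>. \<open>L\<close> is independent of \<open>k\<close>,
  so it can be fixed before \<open>N\<close> grows.\<close>

lemma decay_rate:
  fixes d \<theta> :: real
  assumes d: "0 < d" and \<theta>: "0 < \<theta>" "\<theta> \<le> 1"
  defines "L \<equiv> (2 / \<theta>) powr (1 / d)"
  shows "1 \<le> L" and "1 \<le> k \<Longrightarrow> d * real k \<le> real n \<Longrightarrow> 2 ^ k * (1 / L) ^ n \<le> \<theta>"
proof -
  show L: "1 \<le> L" unfolding L_def using assms by (intro ge_one_powr_ge_zero) auto
  assume k: "1 \<le> k" and n: "d * real k \<le> real n"
  have "(2 / \<theta>) ^ k = L powr (d * real k)"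
    using d \<theta> by (simp add: L_def powr_powr powr_realpow)
  also have "\<dots> \<le> L powr real n" using L n by (intro powr_mono) auto
  also have "\<dots> = L ^ n" using L by (simp add: powr_realpow)
  finally have "2 ^ k / L ^ n \<le> 2 ^ k / (2 / \<theta>) ^ k"
    using L \<theta> by (intro divide_left_mono) auto
  also have "\<dots> = \<theta> ^ k" using \<theta> by (simp add: power_divide)
  also have "\<dots> \<le> \<theta>" using power_decreasing[of 1 k \<theta>] k \<theta> by simp
  finally show "2 ^ k * (1 / L) ^ n \<le> \<theta>" by (simp add: power_divide)
qed

text \<open>At the extremes, \<open>y = \<infinity>\<close> would make the quotient 0, and
  \<open>y = 0\<close> gives the conclusion outright.\<close>

lemma less_of_ratio_greater:
  fixes p L :: real
  assumes "0 < p" "0 < L" "ennreal L < ennreal p / y"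
  shows "y < ennreal (p / L)"
proof (cases y)
  case (real t)
  show ?thesis
  proof (cases "t = 0")
    case False
    then show ?thesis
      using real assms by (auto simp: divide_ennreal ennreal_less_iff field_simps)
  qed (use real assms in \<open>simp add: ennreal_less_zero_iff\<close>)
qed (use assms in auto)

text \<open>Here \<open>y = 0\<close> would make the quotient infinite, and
  \<open>y = \<infinity>\<close> gives the conclusion outright.\<close>

lemma less_of_ratio_less:
  fixes p L :: real
  assumes "0 < p" "0 < L" "ennreal p / y < ennreal (1 / L)"
  shows "ennreal (L * p) < y"
proof (cases y)
  case (real t)
  show ?thesis
  proof (cases "t = 0")
    case True
    then show ?thesis using real assms by (simp add: ennreal_divide_zero)
  next
    case False
    then show ?thesis
      using real assms by (auto simp: divide_ennreal ennreal_less_iff field_simps)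
  qed
qed auto

text \<open>Only an inequality, as \<open>ennreal\<close> sends negative reals to 0; the lower bound
  \<open>1 - q - 4 * d\<close> may be negative.\<close>

lemma ennreal_add_le: "ennreal (a + b) \<le> ennreal a + ennreal b"
  by (cases "0 \<le> a"; cases "0 \<le> b") (auto simp: ennreal_neg intro!: ennreal_leI simp flip: ennreal_plus)

theorem theorem4p5:
  fixes q :: real and k :: "nat \<Rightarrow> nat" and p :: "nat \<Rightarrow> real" and \<A> :: "nat \<Rightarrow> nat set set"
  assumes "0 \<le> q" and "q < 1"
    and "\<And>N. N \<ge> 1 \<Longrightarrow> k N \<ge> 1"
    and "\<And>N. N \<ge> 1 \<Longrightarrow> \<A> N \<noteq> {}"
    and "\<And>N A. N \<ge> 1 \<Longrightarrow> A \<in> \<A> N \<Longrightarrow> A \<subseteq> {1..N} \<and> card A = k N"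
    and "\<And>N. N \<ge> 1 \<Longrightarrow> 0 < p N \<and> p N < 1"
  shows "(((\<lambda>N. ennreal (p N) / psi N (k N) (\<A> N) q) \<longlonglongrightarrow> \<infinity>) \<longrightarrow>
            liminf (\<lambda>N. MinMax N (k N) (\<A> N) (p N)) \<ge> ennreal (1 - q)) \<and>
         (((\<lambda>N. ennreal (p N) / psi N (k N) (\<A> N) q) \<longlonglongrightarrow> 0) \<longrightarrow>
            limsup (\<lambda>N. MinMax N (k N) (\<A> N) (p N)) \<le> ennreal (1 - q))"
proof -
  define MM where "MM N = MinMax N (k N) (\<A> N) (p N)" for N
  define ratio where "ratio N = ennreal (p N) / psi N (k N) (\<A> N) q" for N
  have fam: "planted_family N (k N) (\<A> N) (p N)" if "N \<ge> 1" for N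
    using assms(3,5,6) that by (simp add: planted_family_def)
  have "ennreal (1 - q) \<le> liminf MM" if lim: "ratio \<longlonglongrightarrow> \<infinity>"
  proof (rule ennreal_le_epsilon)
    fix e :: real assume e: "0 < e"
    \<comment> \<open>With \<open>\<epsilon> = d\<close> and \<open>\<theta> = d\<^sup>2\<close> the
      loss in \<open>MinMax_ge\<close> is \<open>d + d + 2 * d\<^sup>2 / d = 4 * d \<le> e\<close>;
      the minimum with 1 ensures \<theta> \<le> 1.\<close>
    define d where "d = min 1 e / 4"
    have d: "0 < d" "d \<le> 1" "4 * d \<le> e" using e by (auto simp: d_def)
    define L where "L = (2 / d\<^sup>2) powr (1 / d)"
    have d2: "0 < d\<^sup>2" "d\<^sup>2 \<le> 1" using d by (auto simp: power_le_one)
    note decay = decay_rate[OF d(1) d2, folded L_def]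
    have "eventually (\<lambda>N. ennreal L < ratio N) sequentially"
      using lim by (rule order_tendstoD) simp
    then have "eventually (\<lambda>N. ennreal (1 - q - 4 * d) \<le> MM N) sequentially"
      using eventually_ge_at_top[of "1::nat"]
    proof eventually_elim
      case (elim N)
      interpret planted_family N "k N" "\<A> N" "p N" by (rule fam[OF elim(2)])
      have "psi N (k N) (\<A> N) q < ennreal (p N / L)"
        using elim(1) p decay(1) by (intro less_of_ratio_greater) (auto simp: ratio_def)
      then have "ennreal (1 - (q + d + d + 2 * d\<^sup>2 / d)) \<le> MM N"
        unfolding MM_def using decay k d assms(1) by (intro MinMax_ge[where L = L]) auto
      moreover have "1 - (q + d + d + 2 * d\<^sup>2 / d) = 1 - q - 4 * d"
        using d by (simp add: power2_eq_square)
      ultimately show ?case by (simp only:)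
    qed
    then have "ennreal (1 - q - 4 * d) \<le> liminf MM" by (rule Liminf_bounded)
    moreover have "ennreal (1 - q) \<le> ennreal (1 - q - 4 * d) + ennreal e"
    proof -
      have "ennreal (1 - q) \<le> ennreal ((1 - q - 4 * d) + e)" using d by (intro ennreal_leI) simp
      also have "\<dots> \<le> ennreal (1 - q - 4 * d) + ennreal e" by (rule ennreal_add_le)
      finally show ?thesis .
    qed
    ultimately show "ennreal (1 - q) \<le> liminf MM + ennreal e"
      by (meson add_right_mono order_trans)
  qed
  moreover have "limsup MM \<le> ennreal (1 - q)" if lim: "ratio \<longlonglongrightarrow> 0"
  proof (rule ennreal_le_epsilon)
    fix e :: real assume e: "0 < e"
    \<comment> \<open>With \<open>\<theta> = d\<close> the loss in \<open>MinMax_le\<close> is at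
      most \<open>2 * d\<close>: one \<open>d\<close> from the overlap level \<open>q - d\<close>,
      one from the factor \<open>1 - d\<close>.\<close>
    define d where "d = min 1 e / 2"
    have d: "0 < d" "d \<le> 1" "2 * d \<le> e" using e by (auto simp: d_def)
    define L where "L = (2 / d) powr (1 / d)"
    note decay = decay_rate[OF d(1) d(1,2), folded L_def]
    have "eventually (\<lambda>N. ratio N < ennreal (1 / L)) sequentially"
      using lim by (rule order_tendstoD) (use decay(1) in simp)
    then have "eventually (\<lambda>N. MM N \<le> ennreal (1 - q + e)) sequentially"
      using eventually_ge_at_top[of "1::nat"]
    proof eventually_elim
      case (elim N)
      interpret planted_family N "k N" "\<A> N" "p N" by (rule fam[OF elim(2)])
      show ?case
      proof (cases "d \<le> q")
        case True
        have "ennreal (L * p N) < psi N (k N) (\<A> N) q"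
          using elim(1) p decay(1) by (intro less_of_ratio_less) (auto simp: ratio_def)
        then have "MM N \<le> ennreal (1 - (q - d) * (1 - d))"
          unfolding MM_def using decay k d True by (intro MinMax_le[where L = L]) auto
        also have "\<dots> \<le> ennreal (1 - q + e)"
        proof (rule ennreal_leI)
          have "1 - (q - d) * (1 - d) = 1 - q + d + q * d - d * d" by (simp add: algebra_simps)
          moreover have "q * d \<le> 1 * d" using assms(2) d by (intro mult_right_mono) auto
          ultimately show "1 - (q - d) * (1 - d) \<le> 1 - q + e"
            using d(3) zero_le_square[of d] by linarith
        qed
        finally show ?thesis .
      next
        case False
        have "MM N \<le> 1" unfolding MM_def by (rule MinMax_le_1)
        also have "1 \<le> ennreal (1 - q + e)"
          unfolding ennreal_1[symmetric] by (rule ennreal_leI) (use False d in simp)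
        finally show ?thesis .
      qed
    qed
    then have "limsup MM \<le> ennreal (1 - q + e)" by (rule Limsup_bounded)
    then show "limsup MM \<le> ennreal (1 - q) + ennreal e"
      using assms(2) e by (simp flip: ennreal_plus)
  qed
  ultimately show ?thesis unfolding MM_def ratio_def by blast
qed

end
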